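(* Let $d\ge3$ and let $P=\{p_1,\ldots,p_d\}$, $Q=\{q_1,\ldots,q_d\}$ be posets. Assume that each of $\Gamma(\mathcal{O}(P),-\mathcal{O}(Q))$, $\Gamma(\mathcal{O}(P),-\mathcal{C}(Q))$ and $\Gamma(\mathcal{C}(P),-\mathcal{C}(Q))$ is a smooth Fano polytope. Then $\Gamma(\mathcal{O}(P),-\mathcal{O}(Q))$ and $\Gamma(\mathcal{C}(P),-\mathcal{C}(Q))$ are unimodularly equivalent, but $\Gamma(\mathcal{O}(P),-\mathcal{C}(Q))$ is not unimodularly equivalent to either of them. Moreover, if $P\neq Q$ (i.e., the map $p_i\mapsto q_i$ is not a poset isomorphism), then $\Gamma(\mathcal{O}(Q),-\mathcal{C}(P))$ is also smooth and is not unimodularly equivalent to $\Gamma(\mathcal{O}(P),-\mathcal{C}(Q))$.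
   Context: For posets $R=\{r_1,\ldots,r_d\}$, $S=\{s_1,\ldots,s_d\}$ and $T\subset R$, $\rho(T)=\sum_{r_i\in T}\mathbf{e}_i\in\mathbb{R}^d$ (similarly for $S$). $\Gamma(\mathcal{O}(R),-\mathcal{O}(S))=\mathrm{conv}(\{\rho(I):I\text{ ideal of }R\}\cup\{-\rho(J):J\text{ ideal of }S\})$, $\Gamma(\mathcal{O}(R),-\mathcal{C}(S))=\mathrm{conv}(\{\rho(I):I\text{ ideal of }R\}\cup\{-\rho(A):A\text{ antichain of }S\})$, $\Gamma(\mathcal{C}(R),-\mathcal{C}(S))=\mathrm{conv}(\{\rho(A):A\text{ antichain of }R\}\cup\{-\rho(B):B\text{ antichain of }S\})$, where poset ideals are down-closed subsets and $\emptyset$ counts as ideal and antichain. A Fano polytope is a $d$-dimensional integral polytope whose only interior lattice point is the origin; it is smooth if the vertices of each facet form a $\mathbb{Z}$-basis of $\mathbb{Z}^d$. Integral $d$-polytopes $\mathcal{P},\mathcal{Q}$ are unimodularly equivalent if $\mathcal{Q}=\{vU:v\in\mathcal{P}\}+w$ for some $U\in\mathbb{Z}^{d\times d}$ with $\det U=\pm1$ and some $w\in\mathbb{Z}^d$. *)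

theory Defs
  imports "HOL-Analysis.Analysis"
begin

text \<open>
  The ambient space is \<^typ>\<open>real ^ 'd\<close> with \<open>d = CARD('d)\<close>. A poset \<open>{r_1, ..., r_d}\<close>
  together with the labelling of its elements is represented by the partial order \<open>R\<close> which it
  induces on the index type \<open>'d\<close>: \<open>(i, j) \<in> R\<close> means that \<open>r_i \<le> r_j\<close>. Under this
  encoding the map \<open>p_i \<mapsto> q_i\<close> is an isomorphism iff the two relations are equal.
\<close>

definition is_poset :: "'d rel \<Rightarrow> bool" where
  "is_poset R \<longleftrightarrow> partial_order_on UNIV R"

definition poset_ideal :: "'d rel \<Rightarrow> 'd set \<Rightarrow> bool" where
  "poset_ideal R I \<longleftrightarrow> (\<forall>j\<in>I. \<forall>i. (i, j) \<in> R \<longrightarrow> i \<in> I)"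

definition poset_antichain :: "'d rel \<Rightarrow> 'd set \<Rightarrow> bool" where
  "poset_antichain R A \<longleftrightarrow> (\<forall>i\<in>A. \<forall>j\<in>A. (i, j) \<in> R \<longrightarrow> i = j)"

definition rho :: "'d::finite set \<Rightarrow> real ^ 'd" where
  "rho T = (\<Sum>i\<in>T. axis i 1)"

definition Gamma_OO :: "'d::finite rel \<Rightarrow> 'd rel \<Rightarrow> (real ^ 'd) set" where
  "Gamma_OO R S = convex hull
     ({rho I |I. poset_ideal R I} \<union> {- rho J |J. poset_ideal S J})"

definition Gamma_OC :: "'d::finite rel \<Rightarrow> 'd rel \<Rightarrow> (real ^ 'd) set" where
  "Gamma_OC R S = convex hull
     ({rho I |I. poset_ideal R I} \<union> {- rho A |A. poset_antichain S A})"

definition Gamma_CC :: "'d::finite rel \<Rightarrow> 'd rel \<Rightarrow> (real ^ 'd) set" where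
  "Gamma_CC R S = convex hull
     ({rho A |A. poset_antichain R A} \<union> {- rho B |B. poset_antichain S B})"

definition int_lattice :: "(real ^ 'd::finite) set" where
  "int_lattice = {x. \<forall>i. x $ i \<in> \<int>}"

definition vertices :: "(real ^ 'd::finite) set \<Rightarrow> (real ^ 'd) set" where
  "vertices S = {v. v extreme_point_of S}"

definition integral_full_polytope :: "(real ^ 'd::finite) set \<Rightarrow> bool" where
  "integral_full_polytope S \<longleftrightarrow>
     polytope S \<and> aff_dim S = int CARD('d) \<and> vertices S \<subseteq> int_lattice"

definition Fano_polytope :: "(real ^ 'd::finite) set \<Rightarrow> bool" where
  "Fano_polytope S \<longleftrightarrow> integral_full_polytope S \<and> interior S \<inter> int_lattice = {0}"

abbreviation int_scale :: "int \<Rightarrow> real ^ 'd::finite \<Rightarrow> real ^ 'd" where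
  "int_scale k x \<equiv> of_int k *\<^sub>R x"

lemma module_int_scale: "module (int_scale :: int \<Rightarrow> real ^ 'd::finite \<Rightarrow> real ^ 'd)"
  by unfold_locales (simp_all add: algebra_simps)

definition lattice_basis :: "(real ^ 'd::finite) set \<Rightarrow> bool" where
  "lattice_basis B \<longleftrightarrow>
     \<not> module.dependent int_scale B \<and> module.span int_scale B = int_lattice"

definition smooth_Fano_polytope :: "(real ^ 'd::finite) set \<Rightarrow> bool" where
  "smooth_Fano_polytope S \<longleftrightarrow>
     Fano_polytope S \<and> (\<forall>F. F facet_of S \<longrightarrow> lattice_basis (vertices F))"

text \<open>Vectors are rows, as in \<open>v U\<close>, hence \<^const>\<open>vector_matrix_mult\<close>.\<close>

definition unimodularly_equivalent ::
    "(real ^ 'd::finite) set \<Rightarrow> (real ^ 'd) set \<Rightarrow> bool" where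
  "unimodularly_equivalent S T \<longleftrightarrow>
     (\<exists>(U :: real ^ 'd ^ 'd) w.
        (\<forall>i j. U $ i $ j \<in> \<int>) \<and> (det U = 1 \<or> det U = - 1) \<and> w \<in> int_lattice \<and>
        T = (\<lambda>v. v v* U + w) ` S)"

end

theory Submission
  imports Defs
begin

text \<open>
  In a smooth polytope the vertices on a supporting hyperplane are linearly independent over
  \<open>\<int>\<close>. Testing this on suitable parallelograms in \<open>\<Gamma>(\<C>(P), -\<C>(Q))\<close>
  shows that every element of \<open>P\<close> (or \<open>Q\<close>) is incomparable to at most one other, and that
  an element having such partners in both posets has the same one; doing so in
  \<open>\<Gamma>(\<O>(P), -\<O>(Q))\<close> shows that incomparable elements are minimal. As the origin is
  interior, \<open>P\<close> and \<open>Q\<close> never order a pair oppositely. Hence \<open>P\<close> and \<open>Q\<close> are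
  a common total order \<open>L\<close> with least elements \<open>a < b\<close>, from which each may drop
  the relation \<open>a < b\<close>.

  The map \<open>e_a \<mapsto> -e_a\<close>, \<open>e_i \<mapsto> \<rho>({j. j \<le> i})\<close> then takes
  \<open>\<Gamma>(\<C>(P), -\<C>(Q))\<close> to \<open>\<Gamma>(\<O>(P), -\<O>(Q))\<close>. These polytopes
  have at most one vertex \<open>v\<close> such that \<open>-v\<close> is not a vertex, whereas
  \<open>\<Gamma>(\<O>(P), -\<C>(Q))\<close> has at least two.
\<close>

section \<open>Vertices and supporting hyperplanes\<close>

interpretation int_mod: module "int_scale :: int \<Rightarrow> real ^ 'd::finite \<Rightarrow> real ^ 'd"
  by (rule module_int_scale)

lemma rho_nth: "rho T $ i = (if i \<in> T then 1 else 0)"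
  by (simp add: rho_def sum_component axis_def)

lemma rho_empty [simp]: "rho {} = 0"
  by (simp add: rho_def)

lemma rho_singleton: "rho {i} = axis i 1"
  by (simp add: rho_def)

lemma rho_inject [simp]: "rho S = rho T \<longleftrightarrow> S = T"
proof
  assume eq: "rho S = rho T"
  have "i \<in> S \<longleftrightarrow> i \<in> T" for i
    using arg_cong[OF eq, of "\<lambda>v. v $ i"] by (auto simp: rho_nth split: if_splits)
  then show "S = T" by blast
qed simp

lemma rho_eq_0_iff [simp]: "rho T = 0 \<longleftrightarrow> T = {}"
  using rho_inject[of T "{}"] by simp

lemma rho_eq_uminus_rho_iff [simp]: "rho S = - rho T \<longleftrightarrow> S = {} \<and> T = {}"
proof
  assume eq: "rho S = - rho T"
  have "i \<notin> S \<and> i \<notin> T" for i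
    using arg_cong[OF eq, of "\<lambda>v. v $ i"] by (auto simp: rho_nth split: if_splits)
  then show "S = {} \<and> T = {}" by blast
qed simp

lemma uminus_rho_eq_rho_iff [simp]: "- rho S = rho T \<longleftrightarrow> S = {} \<and> T = {}"
  by (metis rho_eq_uminus_rho_iff)

lemma rho_insert: "x \<notin> T \<Longrightarrow> rho (insert x T) = axis x 1 + rho T"
  by (simp add: rho_def)

lemma inner_rho_right: "c \<bullet> rho T = (\<Sum>i\<in>T. c $ i)"
  by (simp add: rho_def inner_sum_right inner_axis)

lemma inner_rho_rho: "rho C \<bullet> rho T = real (card (C \<inter> T))"
proof -
  have "rho C \<bullet> rho T = (\<Sum>i\<in>T. if i \<in> C then 1 else 0)"
    by (simp add: inner_rho_right rho_nth)
  also have "\<dots> = real (card (C \<inter> T))"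
    by (simp add: sum.If_cases Int_commute)
  finally show ?thesis .
qed

lemma inner_rho_singleton: "rho {x} \<bullet> rho T = (if x \<in> T then 1 else 0)"
  by (simp add: inner_rho_rho)

lemma rho_in_int_lattice: "rho T \<in> int_lattice" "- rho T \<in> int_lattice"
  by (auto simp: int_lattice_def rho_nth)

lemma strict_max_extreme_point:
  fixes V :: "'a::euclidean_space set"
  assumes "finite V" "v \<in> V" and less: "\<And>w. w \<in> V \<Longrightarrow> w \<noteq> v \<Longrightarrow> c \<bullet> w < c \<bullet> v"
  shows "v extreme_point_of convex hull V"
proof -
  have "convex hull (V - {v}) \<subseteq> {x. c \<bullet> x < c \<bullet> v}"
    by (rule hull_minimal) (use less in \<open>auto simp: convex_halfspace_lt\<close>)
  then have "v \<notin> convex hull (V - {v})" by auto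
  from extreme_point_of_convex_hull_insert[OF _ this] show ?thesis
    using assms(1,2) by (simp add: insert_absorb)
qed

text \<open>The functional \<open>c\<close> built in the proof has its strict maximum over all
  vectors \<open>rho T\<close> and \<open>- rho T\<close> at \<open>rho I\<close>, so
  \<open>rho I\<close> is a vertex whichever other such vectors lie in \<open>V\<close>. Multiplying
  by \<open>s\<close> treats the negative vectors at the same time.\<close>

lemma signed_rho_extreme_point:
  fixes s :: real
  assumes V: "V \<subseteq> range rho \<union> range (\<lambda>T. - rho T)" and s: "s = 1 \<or> s = - 1"
    and mem: "s *\<^sub>R rho I \<in> V" and ne: "I \<noteq> {}"
  shows "s *\<^sub>R rho I extreme_point_of convex hull (V :: (real ^ 'd::finite) set)"
proof -
  obtain x where x: "x \<in> I" using ne by blast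
  \<comment> \<open>The weight \<open>CARD('d)\<close> on a single \<open>x\<close> in
    \<open>I\<close> makes every set missing \<open>x\<close>, and every negative vector, lose to
    \<open>I\<close>; among the sets containing \<open>x\<close> the remaining terms single out
    \<open>I\<close>.\<close>
  define c :: "real ^ 'd" where "c = real CARD('d) *\<^sub>R rho {x} + rho I - rho (- I)"
  have c: "c \<bullet> rho T = (if x \<in> T then real CARD('d) else 0) + real (card (I \<inter> T)) - real (card (- I \<inter> T))" for T
    by (simp add: c_def inner_rho_rho inner_add_left inner_diff_left)
  have pos: "card I > 0" using x card_gt_0_iff finite by blast
  have le: "card (T :: 'd set) \<le> CARD('d)" for T by (simp add: card_mono)
  have less1: "c \<bullet> rho T < c \<bullet> rho I" if "T \<noteq> I" for T
  proof (cases "x \<in> T")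
    case True
    have "real (card (I \<inter> T)) - real (card (- I \<inter> T)) < real (card I)"
    proof (cases "- I \<inter> T = {}")
      case True
      then have "I \<inter> T \<subset> I" using that by blast
      then have "card (I \<inter> T) < card I" by (simp add: psubset_card_mono)
      then show ?thesis by simp
    next
      case False
      then have "0 < card (- I \<inter> T)" by (simp add: card_gt_0_iff)
      moreover have "card (I \<inter> T) \<le> card I" by (simp add: card_mono)
      ultimately show ?thesis by linarith
    qed
    then show ?thesis using True x by (simp add: c)
  next
    case False
    have "card (I \<inter> T) \<le> card I" by (simp add: card_mono)
    moreover have "0 < real CARD('d)" by simp
    ultimately show ?thesis using False x by (simp add: c del: of_nat_0_less_iff)
  qed
  have less2: "c \<bullet> (- rho T) < c \<bullet> rho I" for T
    using x pos le[of "- I \<inter> T"] by (simp add: c)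
  have "finite V" by (rule finite_subset[OF V]) simp
  then show ?thesis
  proof (rule strict_max_extreme_point[where c = "s *\<^sub>R c"])
    fix w assume w: "w \<in> V" "w \<noteq> s *\<^sub>R rho I"
    obtain T where "w = s *\<^sub>R rho T \<or> w = s *\<^sub>R (- rho T)"
    proof -
      from w(1) V consider (p) T where "w = rho T" | (n) T where "w = - rho T" by blast
      then show thesis by cases (use s that in \<open>auto, blast+\<close>)
    qed
    then show "(s *\<^sub>R c) \<bullet> w < (s *\<^sub>R c) \<bullet> (s *\<^sub>R rho I)"
      using s w(2) less1[of T] less2[of T] by auto
  qed (fact mem)
qed

section \<open>Generators and vertices of the three polytopes\<close>

text \<open>One form for all three generating sets. Exchanging \<open>A\<close> and \<open>B\<close>
  negates the set, which is what lets results about \<open>P\<close> carry over to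
  \<open>Q\<close>.\<close>

definition gens :: "('d::finite set \<Rightarrow> bool) \<Rightarrow> ('d set \<Rightarrow> bool) \<Rightarrow> (real ^ 'd) set" where
  "gens A B = {rho I |I. A I} \<union> {- rho J |J. B J}"

lemma Gamma_gens:
  "Gamma_OO R S = convex hull (gens (poset_ideal R) (poset_ideal S))"
  "Gamma_OC R S = convex hull (gens (poset_ideal R) (poset_antichain S))"
  "Gamma_CC R S = convex hull (gens (poset_antichain R) (poset_antichain S))"
  by (simp_all add: Gamma_OO_def Gamma_OC_def Gamma_CC_def gens_def)

lemma gens_subset: "gens A B \<subseteq> range rho \<union> range (\<lambda>T. - rho T)"
  by (auto simp: gens_def)

lemma finite_gens [simp]: "finite (gens A B)"
  by (rule finite_subset[OF gens_subset]) simp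

text \<open>The empty set has to be excluded: \<open>rho {}\<close> equals \<open>- rho {}\<close>,
  so its membership does not tell which of \<open>A\<close> and \<open>B\<close> holds.\<close>

lemma rho_mem_gens: "I \<noteq> {} \<Longrightarrow> rho I \<in> gens A B \<longleftrightarrow> A I"
  by (auto simp: gens_def)

lemma uminus_rho_mem_gens: "J \<noteq> {} \<Longrightarrow> - rho J \<in> gens A B \<longleftrightarrow> B J"
  by (auto simp: gens_def)

lemma nonzero_gens_vertex:
  assumes "v \<in> gens A B" "v \<noteq> 0"
  shows "v \<in> vertices (convex hull (gens A B))"
proof -
  obtain s :: real and I where "s = 1 \<or> s = - 1" "v = s *\<^sub>R rho I" "I \<noteq> {}"
  proof -
    from assms(1) consider (p) I where "v = rho I" | (n) J where "v = - rho J"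
      by (auto simp: gens_def)
    then show thesis
    proof cases
      case p then show ?thesis using that[of 1 I] assms(2) by auto
    next
      case n then show ?thesis using that[of "- 1" J] assms(2) by auto
    qed
  qed
  then show ?thesis
    using signed_rho_extreme_point[OF gens_subset, of s I A B] assms(1) by (simp add: vertices_def)
qed

text \<open>Each nonzero generator is a vertex, and an interior origin is none.\<close>

lemma vertices_gens:
  assumes "0 \<in> interior (convex hull (gens A B))"
  shows "vertices (convex hull (gens A B)) = gens A B - {0}"
proof -
  have "v \<in> gens A B - {0}" if "v \<in> vertices (convex hull (gens A B))" for v
    using that extreme_point_of_convex_hull[of v "gens A B"] assms
      extreme_point_not_in_interior[of v "convex hull (gens A B)"]
    by (auto simp: vertices_def)
  then show ?thesis using nonzero_gens_vertex by blast
qed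

lemma smooth_imp_0_interior: "smooth_Fano_polytope S \<Longrightarrow> 0 \<in> interior S"
  by (auto simp: smooth_Fano_polytope_def Fano_polytope_def)

lemma int_dependent_parallelogram:
  fixes p q r s :: "real ^ 'd::finite"
  assumes "distinct [p, q, r, s]" "p + q = r + s" "{p, q, r, s} \<subseteq> B"
  shows "int_mod.dependent B"
  unfolding int_mod.dependent_explicit
proof (intro exI conjI)
  show "(\<Sum>v\<in>{p, q, r, s}. int_scale (if v = p \<or> v = q then 1 else - 1) v) = 0"
    using assms(1,2) by (auto simp: algebra_simps)
qed (use assms in auto)

lemma uminus_gens: "v \<in> gens A B \<longleftrightarrow> - v \<in> gens B A"
  by (auto simp: gens_def minus_equation_iff[of v])

text \<open>In a smooth polytope the vertices
  on any supporting hyperplane lie on a common facet, so they cannot form a parallelogram.\<close>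

lemma smooth_no_parallelogram:
  assumes smooth: "smooth_Fano_polytope (convex hull (gens A B))"
    and le: "\<And>I. A I \<Longrightarrow> c \<bullet> rho I \<le> 1" "\<And>J. B J \<Longrightarrow> - 1 \<le> c \<bullet> rho J"
    and mem: "{p, q, r, s} \<subseteq> gens A B"
    and one: "c \<bullet> p = 1" "c \<bullet> q = 1" "c \<bullet> r = 1" "c \<bullet> s = 1"
    and dist: "distinct [p, q, r, s]" and eq: "p + q = r + s"
  shows False
proof -
  let ?S = "convex hull (gens A B)"
  let ?G = "?S \<inter> {x. c \<bullet> x = 1}"
  have sub: "?S \<subseteq> {x. c \<bullet> x \<le> 1}"
    by (rule hull_minimal) (use le in \<open>fastforce simp: gens_def convex_halfspace_le\<close>)+
  have face: "?G face_of ?S"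
    by (rule face_of_Int_supporting_hyperplane_le) (use sub in auto)
  have inG: "{p, q, r, s} \<subseteq> ?G" using mem one hull_subset[of "gens A B" convex] by auto
  have "0 \<in> ?S" using smooth_imp_0_interior[OF smooth] interior_subset by blast
  \<comment> \<open>The origin lies in the polytope but has \<open>c\<close>-value 0, so
    \<open>?G\<close> is a proper face and extends to a facet.\<close>
  then have "?G \<noteq> ?S" by force
  moreover have "polyhedron ?S"
    by (simp add: polytope_imp_polyhedron polytope_convex_hull)
  ultimately obtain F where F: "F facet_of ?S" "?G \<subseteq> F"
    using face_of_polyhedron_subset_facet[OF _ face] inG by blast
  have "v \<in> vertices F" if "v \<in> {p, q, r, s}" for v
  proof -
    have "v \<noteq> 0" using one that by auto
    then have "v \<in> vertices ?S" using nonzero_gens_vertex mem that by blast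
    then show ?thesis
      using extreme_point_of_face[OF facet_of_imp_face_of[OF F(1)]] F(2) inG that
      by (auto simp: vertices_def)
  qed
  then have "int_mod.dependent (vertices F)"
    by (intro int_dependent_parallelogram[OF dist eq]) auto
  then show False
    using smooth F(1) by (auto simp: smooth_Fano_polytope_def lattice_basis_def)
qed

text \<open>Negating \<open>c\<close> and the four points turns a parallelogram for
  \<open>gens A B\<close> into one for \<open>gens B A\<close>. Hence each restriction below is
  proved for one poset and applies to both.\<close>

lemma smooth_no_parallelogram':
  assumes smooth: "smooth_Fano_polytope (convex hull (gens A B)) \<or> smooth_Fano_polytope (convex hull (gens B A))"
    and le: "\<And>I. A I \<Longrightarrow> c \<bullet> rho I \<le> 1" "\<And>J. B J \<Longrightarrow> - 1 \<le> c \<bullet> rho J"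
    and mem: "p \<in> gens A B" "q \<in> gens A B" "r \<in> gens A B" "s \<in> gens A B"
    and one: "c \<bullet> p = 1" "c \<bullet> q = 1" "c \<bullet> r = 1" "c \<bullet> s = 1"
    and dist: "distinct [p, q, r, s]" and eq: "p + q = r + s"
  shows False
  using smooth
proof
  assume "smooth_Fano_polytope (convex hull (gens A B))"
  then show False
    by (rule smooth_no_parallelogram[where c = c and p = p and q = q and r = r and s = s])
      (use assms in auto)
next
  assume "smooth_Fano_polytope (convex hull (gens B A))"
  then show False
    by (rule smooth_no_parallelogram[where c = "- c" and p = "- p" and q = "- q" and r = "- r" and s = "- s"])
      (use le[THEN le_imp_neg_le] one dist eq mem in \<open>auto simp: uminus_gens[of _ A B] algebra_simps\<close>)
qed

section \<open>Restrictions on the posets\<close>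

definition incomparable :: "'d rel \<Rightarrow> 'd \<Rightarrow> 'd \<Rightarrow> bool" where
  "incomparable R x y \<longleftrightarrow> (x, y) \<notin> R \<and> (y, x) \<notin> R"

lemma incomparable_sym: "incomparable R x y \<Longrightarrow> incomparable R y x"
  by (simp add: incomparable_def)

lemma is_posetD:
  assumes "is_poset R"
  shows "(x, x) \<in> R" "(x, y) \<in> R \<Longrightarrow> (y, x) \<in> R \<Longrightarrow> x = y"
    "(x, y) \<in> R \<Longrightarrow> (y, z) \<in> R \<Longrightarrow> (x, z) \<in> R"
  using assms unfolding is_poset_def partial_order_on_def preorder_on_def refl_on_def antisym_def trans_def
  by blast+

lemma is_posetI:
  assumes "\<And>x. (x, x) \<in> R" "\<And>x y. (x, y) \<in> R \<Longrightarrow> (y, x) \<in> R \<Longrightarrow> x = y"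
    "\<And>x y z. (x, y) \<in> R \<Longrightarrow> (y, z) \<in> R \<Longrightarrow> (x, z) \<in> R"
  shows "is_poset R"
  unfolding is_poset_def partial_order_on_def preorder_on_def refl_on_def antisym_def trans_def
  by (intro conjI ballI allI impI; (erule (1) assms(2) | erule (1) assms(3) | simp add: assms(1)))

lemma incomparable_neq: "is_poset R \<Longrightarrow> incomparable R x y \<Longrightarrow> x \<noteq> y"
  using is_posetD(1) by (force simp: incomparable_def)

lemma card_antichain_Int_chain:
  fixes R :: "'d::finite rel"
  assumes "poset_antichain R A" "\<And>x y. x \<in> C \<Longrightarrow> y \<in> C \<Longrightarrow> (x, y) \<in> R \<or> (y, x) \<in> R"
  shows "card (C \<inter> A) \<le> 1"
proof -
  have "x = y" if "x \<in> C \<inter> A" "y \<in> C \<inter> A" for x y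
    using that assms(1) assms(2)[of x y] by (auto simp: poset_antichain_def)
  then show ?thesis by (simp add: card_le_Suc0_iff_eq)
qed

lemma antichain_singleton [simp]: "poset_antichain R {i}"
  by (simp add: poset_antichain_def)

lemma antichain_pair: "incomparable R i j \<Longrightarrow> poset_antichain R {i, j}"
  by (auto simp: poset_antichain_def incomparable_def)

text \<open>Two partners \<open>y\<close>, \<open>z\<close> of \<open>x\<close> give a
  parallelogram. If \<open>y\<close> and \<open>z\<close> are comparable, it is {x,y} + {z} = {x,z}
  + {y}, on the hyperplane where the coordinates of \<open>y\<close> and \<open>z\<close> add up to
  1, supporting because an antichain meets a chain at most once. Otherwise it is {x,y} + {x,z} = {x}
  + {x,y,z}, on the hyperplane where the coordinate of \<open>x\<close> is 1.\<close>

lemma CC_incomparable_unique: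
  assumes smooth: "smooth_Fano_polytope (Gamma_CC P Q) \<or> smooth_Fano_polytope (Gamma_CC Q P)"
    and P: "is_poset P"
    and inc: "incomparable P x y" "incomparable P x z"
  shows "y = z"
proof (rule ccontr)
  assume "y \<noteq> z"
  have ne: "x \<noteq> y" "x \<noteq> z" using incomparable_neq[OF P] inc by auto
  note no = smooth_no_parallelogram'[OF smooth[unfolded Gamma_gens]]
  show False
  proof (cases "incomparable P y z")
    case False
    have "card ({y, z} \<inter> A) \<le> 1" if "poset_antichain P A" for A
      using that by (rule card_antichain_Int_chain)
        (use False is_posetD(1)[OF P] in \<open>auto simp: incomparable_def\<close>)
    moreover have "rho {x, y} + rho {z} = rho {x, z} + rho {y}"
      using ne \<open>y \<noteq> z\<close> by (simp add: rho_insert rho_singleton algebra_simps)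
    ultimately show False
      by (intro no[where c = "rho {y, z}" and p = "rho {x, y}" and q = "rho {z}"
            and r = "rho {x, z}" and s = "rho {y}"])
        (use ne \<open>y \<noteq> z\<close> antichain_pair[OF inc(1)] antichain_pair[OF inc(2)] in
          \<open>auto simp: inner_rho_rho rho_mem_gens doubleton_eq_iff
             intro: order_trans[of _ 0]\<close>)
  next
    case True
    have anti: "poset_antichain P {x, y, z}"
      using True inc by (auto simp: poset_antichain_def incomparable_def)
    have "rho {x, y} + rho {x, z} = rho {x} + rho {x, y, z}"
      using ne \<open>y \<noteq> z\<close> by (simp add: rho_insert rho_singleton algebra_simps)
    then show False
      by (intro no[where c = "rho {x}" and p = "rho {x, y}" and q = "rho {x, z}"
            and r = "rho {x}" and s = "rho {x, y, z}"])
        (use ne \<open>y \<noteq> z\<close> antichain_pair[OF inc(1)] antichain_pair[OF inc(2)] anti in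
          \<open>auto simp: inner_rho_singleton rho_mem_gens doubleton_eq_iff
             intro: order_trans[of _ 0] split: if_splits\<close>)
  qed
qed

text \<open>If \<open>z\<close> differs from \<open>x\<close>, the parallelogram {x,y} - {y,z} = {x}
  - {z} lies where the coordinate of \<open>x\<close> minus that of \<open>z\<close> is 1. This
  hyperplane is supporting since a difference of two 0/1 coordinates is between -1 and 1.\<close>

lemma CC_incomparable_agree:
  assumes smooth: "smooth_Fano_polytope (Gamma_CC P Q)"
    and P: "is_poset P" and Q: "is_poset Q"
    and inc: "incomparable P x y" "incomparable Q y z"
  shows "z = x"
proof (rule ccontr)
  assume "z \<noteq> x"
  have ne: "x \<noteq> y" "y \<noteq> z"
    using incomparable_neq[OF P inc(1)] incomparable_neq[OF Q inc(2)] by auto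
  have "rho {x, y} + - rho {y, z} = rho {x} + - rho {z}"
    using ne by (simp add: rho_insert rho_singleton)
  then show False
    by (intro smooth_no_parallelogram'[OF disjI1[OF smooth[unfolded Gamma_gens]],
          where c = "rho {x} - rho {z}" and p = "rho {x, y}" and q = "- rho {y, z}"
            and r = "rho {x}" and s = "- rho {z}"])
      (use ne \<open>z \<noteq> x\<close> antichain_pair[OF inc(1)] antichain_pair[OF inc(2)] in
        \<open>auto simp: inner_rho_singleton inner_diff_left rho_mem_gens uminus_rho_mem_gens doubleton_eq_iff\<close>)
qed

text \<open>Let \<open>I\<close> consist of the elements strictly below \<open>x\<close> or
  \<open>y\<close>. Adding \<open>x\<close>, \<open>y\<close> or both to \<open>I\<close> gives
  ideals again, and together with \<open>I\<close> they form a parallelogram. An element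
  \<open>z\<close> strictly below \<open>x\<close> lies in all four, so the coordinate of
  \<open>z\<close> supplies the supporting hyperplane.\<close>

lemma OO_incomparable_minimal:
  assumes smooth: "smooth_Fano_polytope (Gamma_OO P Q) \<or> smooth_Fano_polytope (Gamma_OO Q P)"
    and P: "is_poset P"
    and inc: "incomparable P x y" and zx: "(z, x) \<in> P"
  shows "z = x"
proof (rule ccontr)
  assume "z \<noteq> x"
  define I where "I = {w. (w \<noteq> x \<and> (w, x) \<in> P) \<or> (w \<noteq> y \<and> (w, y) \<in> P)}"
  note poset = is_posetD[OF P]
  have xy: "x \<noteq> y" using incomparable_neq[OF P inc] .
  have notin: "x \<notin> I" "y \<notin> I" and zI: "z \<in> I"
    using inc zx \<open>z \<noteq> x\<close> by (auto simp: I_def incomparable_def)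
  have ideals: "poset_ideal P I" "poset_ideal P (insert x I)" "poset_ideal P (insert y I)"
    "poset_ideal P (insert x (insert y I))"
    unfolding poset_ideal_def I_def using poset by blast+
  have "rho (insert x I) + rho (insert y I) = rho I + rho (insert x (insert y I))"
    using xy notin by (simp add: rho_insert algebra_simps)
  moreover have "insert x I \<noteq> insert y I" "insert x I \<noteq> I" "insert x I \<noteq> insert x (insert y I)"
    "insert y I \<noteq> I" "insert y I \<noteq> insert x (insert y I)" "I \<noteq> insert x (insert y I)" "I \<noteq> {}"
    using xy notin zI by auto
  ultimately show False
    by (intro smooth_no_parallelogram'[OF smooth[unfolded Gamma_gens],
          where c = "rho {z}" and p = "rho (insert x I)" and q = "rho (insert y I)"
            and r = "rho I" and s = "rho (insert x (insert y I))"])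
      (simp_all add: zI ideals rho_mem_gens inner_rho_singleton)
qed

text \<open>Ideals of \<open>P\<close> containing \<open>j\<close> contain \<open>i\<close>, and
  ideals of \<open>Q\<close> containing \<open>i\<close> contain \<open>j\<close>. So e_i - e_j is
  nonnegative on the whole polytope, and the origin would lie on the boundary.\<close>

lemma OO_no_reversed_pair:
  fixes P Q :: "'d::finite rel"
  assumes "smooth_Fano_polytope (Gamma_OO P Q)"
    and ij: "(i, j) \<in> P" and ji: "(j, i) \<in> Q"
  shows "i = j"
proof (rule ccontr)
  assume "i \<noteq> j"
  define c :: "real ^ 'd" where "c = rho {i} - rho {j}"
  have "c \<noteq> 0" using \<open>i \<noteq> j\<close> by (simp add: c_def)
  have "Gamma_OO P Q \<subseteq> {x. c \<bullet> x \<ge> 0}"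
    unfolding Gamma_gens
  proof (rule hull_minimal)
    show "gens (poset_ideal P) (poset_ideal Q) \<subseteq> {x. c \<bullet> x \<ge> 0}"
      using ij ji by (auto simp: gens_def c_def inner_diff_left inner_rho_singleton poset_ideal_def)
  qed (rule convex_halfspace_ge)
  then have "interior (Gamma_OO P Q) \<subseteq> interior {x. c \<bullet> x \<ge> 0}" by (rule interior_mono)
  then show False
    using smooth_imp_0_interior[OF assms(1)] \<open>c \<noteq> 0\<close> by auto
qed

text \<open>A total order \<open>L\<close> with least element \<open>a\<close> and second least element \<open>b\<close>;
  dropping \<open>(a, b)\<close> makes these two minimal and incomparable.\<close>

locale forked_chain =
  fixes L :: "'d::finite rel" and a b :: 'd
  assumes poset: "is_poset L"
    and total: "(x, y) \<in> L \<or> (y, x) \<in> L"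
    and least: "(a, x) \<in> L"
    and second: "x \<noteq> a \<Longrightarrow> (b, x) \<in> L"
    and a_neq_b: "a \<noteq> b"

text \<open>The flag \<open>p\<close> says whether the relation is dropped, so that \<open>P\<close>
  and \<open>Q\<close> become forks of one chain with independent flags.\<close>

definition fork :: "'d rel \<Rightarrow> 'd \<Rightarrow> 'd \<Rightarrow> bool \<Rightarrow> 'd rel" where
  "fork L a b p = (if p then L - {(a, b)} else L)"

lemma finite_total_least:
  fixes R :: "'d rel"
  assumes "is_poset R" "\<And>x y. (x, y) \<in> R \<or> (y, x) \<in> R" "finite S" "S \<noteq> {}"
  shows "\<exists>m\<in>S. \<forall>x\<in>S. (m, x) \<in> R"
  using assms(3,4)
proof (induction S rule: finite_ne_induct)
  case (singleton x)
  then show ?case using is_posetD(1)[OF assms(1)] by auto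
next
  case (insert y S)
  then obtain m where m: "m \<in> S" "\<forall>x\<in>S. (m, x) \<in> R" by blast
  show ?case
  proof (cases "(m, y) \<in> R")
    case True then show ?thesis using m by blast
  next
    case False
    then have "(y, m) \<in> R" using assms(2) by blast
    then show ?thesis using m is_posetD(1,3)[OF assms(1)] by blast
  qed
qed

lemma total_forked_chain:
  fixes R :: "'d::finite rel"
  assumes R: "is_poset R" and total: "\<And>x y. (x, y) \<in> R \<or> (y, x) \<in> R" and card: "CARD('d) \<ge> 2"
  shows "\<exists>a b. forked_chain R a b"
proof -
  obtain a where a: "\<forall>x. (a, x) \<in> R"
    using finite_total_least[OF R total, of UNIV] by auto
  have "\<not> UNIV \<subseteq> {a}"
  proof
    assume "UNIV \<subseteq> {a}"
    then have "CARD('d) \<le> card {a}" by (intro card_mono) auto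
    then show False using card by simp
  qed
  then obtain b where "b \<in> - {a}" "\<forall>x\<in>- {a}. (b, x) \<in> R"
    using finite_total_least[OF R total, of "- {a}"] by auto
  then show ?thesis
    using R total a by (intro exI[of _ a] exI[of _ b]) (unfold_locales, auto)
qed

section \<open>Classification of the pairs of posets\<close>

text \<open>This collects what the parallelograms give for a single poset. Incomparability is
  symmetric, so both members of an incomparable pair are minimal.\<close>

definition unique_minimal_pairs :: "'d rel \<Rightarrow> bool" where
  "unique_minimal_pairs R \<longleftrightarrow>
    (\<forall>x y z. incomparable R x y \<longrightarrow> (incomparable R x z \<longrightarrow> y = z) \<and> ((z, x) \<in> R \<longrightarrow> z = x))"

text \<open>By uniqueness of the partner, \<open>z\<close> is comparable to \<open>x\<close>; by
  minimality of \<open>x\<close>, it is not below \<open>x\<close>.\<close>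

lemma below_others:
  assumes "unique_minimal_pairs R" "incomparable R x y" "z \<noteq> x" "z \<noteq> y"
  shows "(x, z) \<in> R"
  using assms unfolding unique_minimal_pairs_def incomparable_def by metis

text \<open>An element outside {x,y} lies strictly above \<open>x\<close>, hence is not minimal and
  cannot belong to an incomparable pair.\<close>

lemma unique_incomparable_pair:
  assumes "is_poset R" "unique_minimal_pairs R" "incomparable R x y" "incomparable R z w"
  shows "z = x \<and> w = y \<or> z = y \<and> w = x"
proof -
  have "z = x \<or> z = y"
    using below_others[OF assms(2,3)] assms(2,4) unfolding unique_minimal_pairs_def by metis
  moreover have "w = x \<or> w = y"
    using below_others[OF assms(2,3)] assms(2) incomparable_sym[OF assms(4)]
    unfolding unique_minimal_pairs_def by metis
  ultimately show ?thesis using incomparable_neq[OF assms(1,4)] by auto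
qed

text \<open>Either \<open>Q\<close> has the same incomparable pair, and then both posets equal the
  chain without the relation between \<open>x\<close> and \<open>y\<close>; or \<open>Q\<close> is
  total and is itself the chain.\<close>

lemma fork_cases_pair:
  fixes P Q :: "'d::finite rel"
  assumes P: "is_poset P" "unique_minimal_pairs P" and Q: "is_poset Q" "unique_minimal_pairs Q"
    and consistent: "\<And>i j. (i, j) \<in> P \<Longrightarrow> (j, i) \<in> Q \<Longrightarrow> i = j"
    and agree: "\<And>x y z. incomparable P x y \<Longrightarrow> incomparable Q y z \<Longrightarrow> z = x"
    and inc: "incomparable P x y"
  shows "\<exists>L a b q. forked_chain L a b \<and> P = fork L a b True \<and> Q = fork L a b q"
proof -
  have "x \<noteq> y" using incomparable_neq[OF P(1) inc] .
  have comp: "(z, w) \<in> P \<or> (w, z) \<in> P" if "\<not> (z = x \<and> w = y)" "\<not> (z = y \<and> w = x)" for z w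
    using unique_incomparable_pair[OF P inc, of z w] that by (auto simp: incomparable_def)
  note above = below_others[OF P(2) inc] below_others[OF P(2) incomparable_sym[OF inc]]
  have notP: "(x, y) \<notin> P" "(y, x) \<notin> P" using inc by (auto simp: incomparable_def)
  note PD = is_posetD[OF P(1)] and QD = is_posetD[OF Q(1)]
  show ?thesis
  proof (cases "incomparable Q x y")
    case True
    have compQ: "(z, w) \<in> Q \<or> (w, z) \<in> Q" if "\<not> (z = x \<and> w = y)" "\<not> (z = y \<and> w = x)" for z w
      using unique_incomparable_pair[OF Q True, of z w] that by (auto simp: incomparable_def)
    have notQ: "(x, y) \<notin> Q" "(y, x) \<notin> Q" using True by (auto simp: incomparable_def)
    have "(z, w) \<in> P \<longleftrightarrow> (z, w) \<in> Q" for z w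
      using consistent compQ[of z w] comp[of z w] PD(1) QD(1) notP notQ by metis
    then have "P = Q" by auto
    \<comment> \<open>As \<open>x\<close>, \<open>y\<close> is the only incomparable pair, this
      makes the order total; the opposite direction would serve equally well.\<close>
    define L where "L = insert (x, y) P"
    have min: "z = x" if "(z, x) \<in> P" for z
      using that inc P(2) unfolding unique_minimal_pairs_def by blast
    have "is_poset L"
    proof (rule is_posetI)
      show "(i, i) \<in> L" for i using PD(1) by (simp add: L_def)
      show "i = j" if "(i, j) \<in> L" "(j, i) \<in> L" for i j
        using that notP PD(2) by (auto simp: L_def)
      show "(i, k) \<in> L" if "(i, j) \<in> L" "(j, k) \<in> L" for i j k
      proof (cases "(i, j) = (x, y)")
        case True
        then show ?thesis using that(2) notP above(1)[of k] PD(1) unfolding L_def by (cases "k = y"; cases "k = x"; simp)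
      next
        case False
        then have "(i, j) \<in> P" using that(1) unfolding L_def by blast
        then show ?thesis using that(2) min[of i] PD(3)[of i j k] unfolding L_def by auto
      qed
    qed
    then have "forked_chain L x y"
      using \<open>x \<noteq> y\<close> above comp PD(1) by unfold_locales (auto simp: L_def, metis+)
    moreover have "P = fork L x y True" using notP unfolding fork_def L_def by auto
    ultimately show ?thesis using \<open>P = Q\<close> by blast
  next
    case False
    \<comment> \<open>An incomparable pair \<open>z\<close>, \<open>w\<close> of \<open>Q\<close>
      would be disjoint from {x,y} by \<open>agree\<close>. Then \<open>x\<close> is below
      \<open>z\<close> in \<open>P\<close>, while \<open>z\<close> is below \<open>x\<close> in
      \<open>Q\<close>.\<close>
    have totalQ: "(z, w) \<in> Q \<or> (w, z) \<in> Q" for z w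
    proof (rule ccontr)
      assume "\<not> ?thesis"
      then have zw: "incomparable Q z w" by (simp add: incomparable_def)
      have "z \<noteq> x" "z \<noteq> y" "w \<noteq> x" "w \<noteq> y"
        using agree inc zw False incomparable_sym by metis+
      then show False
        using above(1)[of z] below_others[OF Q(2) zw, of x] consistent by metis
    qed
    \<comment> \<open>The order of \<open>x\<close> and \<open>y\<close> in \<open>Q\<close> decides
      which of them is the least element \<open>u\<close>.\<close>
    have chain: "forked_chain Q u v \<and> P = fork Q u v True"
      if uv: "u = x \<and> v = y \<or> u = y \<and> v = x" and uvQ: "(u, v) \<in> Q" for u v
    proof
      have PQ: "(i, j) \<in> Q" if "(i, j) \<in> P" for i j
        using consistent totalQ QD(1) that by metis
      show "forked_chain Q u v"
      proof
        show "(u, i) \<in> Q" for i using uv uvQ above[of i] PQ QD(1) by metis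
        show "(v, i) \<in> Q" if "i \<noteq> u" for i using uv that above[of i] PQ QD(1) by metis
      qed (use Q(1) totalQ uv \<open>x \<noteq> y\<close> in auto)
      have "(i, j) \<in> P \<longleftrightarrow> (i, j) \<in> Q \<and> (i, j) \<noteq> (u, v)" for i j
        using PQ uv uvQ notP comp[of i j] consistent QD PD(1) by (metis prod.inject)
      then show "P = fork Q u v True" by (auto simp: fork_def)
    qed
    moreover have "Q = fork Q u v False" for u v by (simp add: fork_def)
    ultimately show ?thesis using totalQ[of x y] by blast
  qed
qed

lemma fork_cases:
  fixes P Q :: "'d::finite rel"
  assumes card: "CARD('d) \<ge> 2"
    and P: "is_poset P" "unique_minimal_pairs P" and Q: "is_poset Q" "unique_minimal_pairs Q"
    and consistent: "\<And>i j. (i, j) \<in> P \<Longrightarrow> (j, i) \<in> Q \<Longrightarrow> i = j"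
    and agree: "\<And>x y z. incomparable P x y \<Longrightarrow> incomparable Q y z \<Longrightarrow> z = x"
  shows "\<exists>L a b p q. forked_chain L a b \<and> P = fork L a b p \<and> Q = fork L a b q"
proof -
  consider (P) x y where "incomparable P x y" | (Q) x y where "incomparable Q x y"
    | (total) "\<And>x y. \<not> incomparable P x y" "\<And>x y. \<not> incomparable Q x y" by blast
  then show ?thesis
  proof cases
    case P
    from fork_cases_pair[OF assms(2-5) consistent agree P]
    have "\<exists>L a b q. forked_chain L a b \<and> P = fork L a b True \<and> Q = fork L a b q" .
    then show ?thesis by blast
  next
    case Q
    have agree': "z = x" if "incomparable Q x y" "incomparable P y z" for x y z
      using agree[of z y x] that incomparable_sym by metis
    have consistent': "i = j" if "(i, j) \<in> Q" "(j, i) \<in> P" for i j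
      using consistent that by metis
    from fork_cases_pair[OF assms(4,5,2,3) consistent' agree' Q]
    have "\<exists>L a b q. forked_chain L a b \<and> Q = fork L a b True \<and> P = fork L a b q" .
    then show ?thesis by blast
  next
    case total
    then have tot: "(x, y) \<in> P \<or> (y, x) \<in> P" "(x, y) \<in> Q \<or> (y, x) \<in> Q" for x y
      by (auto simp: incomparable_def)
    then have "(x, y) \<in> P \<longleftrightarrow> (x, y) \<in> Q" for x y
      using consistent is_posetD(1)[OF P(1)] is_posetD(1)[OF Q(1)] by metis
    then have "P = Q" by auto
    then show ?thesis
      using total_forked_chain[OF P(1) tot(1) card] by (metis fork_def)
  qed
qed

section \<open>Ideals and antichains of forked chains\<close>

context forked_chain
begin

definition down :: "'d \<Rightarrow> 'd set" where "down k = {j. (j, k) \<in> L}"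
text \<open>The position in the chain, counted from 1; it turns questions about \<open>L\<close>
  into comparisons of natural numbers.\<close>

definition rank :: "'d \<Rightarrow> nat" where "rank k = card (down k)"

lemma self_in_down [simp]: "k \<in> down k"
  using is_posetD(1)[OF poset] by (simp add: down_def)

lemma down_subset_iff: "down j \<subseteq> down k \<longleftrightarrow> (j, k) \<in> L"
  using is_posetD(1,3)[OF poset] unfolding down_def by blast

lemma L_iff_rank: "(j, k) \<in> L \<longleftrightarrow> rank j \<le> rank k"
proof
  assume "(j, k) \<in> L"
  then show "rank j \<le> rank k" unfolding rank_def by (intro card_mono) (auto simp: down_subset_iff)
next
  assume le: "rank j \<le> rank k"
  show "(j, k) \<in> L"
  proof (rule ccontr)
    assume "(j, k) \<notin> L"
    then have "down k \<subset> down j" using total down_subset_iff by blast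
    then have "rank k < rank j" unfolding rank_def by (intro psubset_card_mono) auto
    then show False using le by simp
  qed
qed

lemma in_down_iff: "j \<in> down k \<longleftrightarrow> rank j \<le> rank k"
  by (simp add: down_def L_iff_rank)

lemma rank_inject [simp]: "rank j = rank k \<longleftrightarrow> j = k"
  using is_posetD(2)[OF poset] by (metis L_iff_rank order_refl)

lemma down_inject [simp]: "down j = down k \<longleftrightarrow> j = k"
  using in_down_iff rank_inject by (metis order_antisym order_refl)

lemma down_nonempty [simp]: "down k \<noteq> {}" "{} \<noteq> down k"
  using self_in_down by blast+

lemma rank_a_less: "x \<noteq> a \<Longrightarrow> rank a < rank x"
  using least[of x] by (simp add: L_iff_rank order_less_le)

lemma rank_b_less: "x \<noteq> a \<Longrightarrow> x \<noteq> b \<Longrightarrow> rank b < rank x"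
  using second[of x] by (simp add: L_iff_rank order_less_le)

lemma down_a: "down a = {a}"
  using rank_a_less by (auto simp: in_down_iff) (metis not_le)

lemma down_b: "down b = {a, b}"
  using rank_a_less[of b] rank_b_less a_neq_b
  by (auto simp: in_down_iff less_imp_le) (metis not_le)

lemma initial_segment:
  assumes "I \<noteq> {}" "\<And>j k. k \<in> I \<Longrightarrow> rank j \<le> rank k \<Longrightarrow> j \<in> I"
  obtains k where "k \<in> I" "I = down k"
proof -
  have "Max (rank ` I) \<in> rank ` I" using assms(1) by (intro Max_in) auto
  then obtain k where "k \<in> I" "rank k = Max (rank ` I)" by (metis imageE)
  then have "rank j \<le> rank k" if "j \<in> I" for j using that by simp
  then have "I = down k" using \<open>k \<in> I\<close> assms(2) in_down_iff by blast
  then show thesis using that \<open>k \<in> I\<close> by blast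
qed

text \<open>Here \<open>j\<close> is the immediate predecessor of \<open>k\<close>. The lemma serves
  to write \<open>rho {k}\<close> as \<open>rho (down k) - rho (down j)\<close> when going up the
  chain.\<close>

lemma down_pred:
  assumes "k \<noteq> a"
  obtains j where "rank j < rank k" "down k = insert k (down j)" "k \<notin> down j"
proof -
  have "{i. rank i < rank k} \<noteq> {}" using rank_a_less[OF assms] by blast
  then obtain j where j: "rank j < rank k" "{i. rank i < rank k} = down j"
    using initial_segment[of "{i. rank i < rank k}"] by (metis (mono_tags, lifting) mem_Collect_eq order_le_less_trans)
  have "down k = insert k (down j)"
    unfolding j(2)[symmetric] by (auto simp: in_down_iff order_le_less)
  then show thesis using that[of j] j by (auto simp: in_down_iff)
qed

text \<open>The nonempty ideals of a chain are principal, and dropping the relation between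
  \<open>a\<close> and \<open>b\<close> frees only {b}: a set with any further element is forced to
  contain \<open>a\<close>.\<close>

lemma ideal_fork_iff:
  "poset_ideal (fork L a b p) I \<longleftrightarrow> I = {} \<or> (\<exists>k. I = down k) \<or> p \<and> I = {b}"
proof
  assume ideal: "poset_ideal (fork L a b p) I"
  show "I = {} \<or> (\<exists>k. I = down k) \<or> p \<and> I = {b}"
  proof (cases "I = {} \<or> p \<and> I = {b}")
    case False
    have "j \<in> I" if k: "k \<in> I" and jk: "rank j \<le> rank k" for j k
    proof (cases "j = a \<and> k = b \<and> p")
      case True
      \<comment> \<open>The dropped relation is recovered through another element \<open>i\<close>
        of \<open>I\<close>, which is still above \<open>a\<close> in the fork.\<close>
      then obtain i where i: "i \<in> I" "i \<noteq> b" using False k by blast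
      have "(a, i) \<in> fork L a b p" using i least[of i] by (auto simp: fork_def)
      then show ?thesis using i ideal True by (auto simp: poset_ideal_def)
    next
      case False
      then have "(j, k) \<in> fork L a b p" using jk by (auto simp: fork_def L_iff_rank)
      then show ?thesis using ideal k by (auto simp: poset_ideal_def)
    qed
    then show ?thesis using initial_segment[of I] False by metis
  qed auto
next
  have "rank i \<noteq> rank b \<Longrightarrow> rank i \<le> rank b \<Longrightarrow> i = a" for i
    using down_b in_down_iff[of i b] by auto
  then show "I = {} \<or> (\<exists>k. I = down k) \<or> p \<and> I = {b} \<Longrightarrow> poset_ideal (fork L a b p) I"
    by (auto simp: poset_ideal_def fork_def in_down_iff L_iff_rank split: if_splits)
qed

text \<open>The new antichain {a,b} is written as \<open>down b\<close>. Compared with the ideals,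
  singletons and principal ideals have changed places, which is the pattern behind the unimodular
  map.\<close>

lemma antichain_fork_iff:
  "poset_antichain (fork L a b p) A \<longleftrightarrow> A = {} \<or> (\<exists>k. A = {k}) \<or> p \<and> A = down b"
proof
  assume anti: "poset_antichain (fork L a b p) A"
  have ab: "p \<and> {i, j} = {a, b}" if "i \<in> A" "j \<in> A" "i \<noteq> j" for i j
    using total[of i j] anti that unfolding poset_antichain_def fork_def
    by (cases p) (auto split: if_splits)
  show "A = {} \<or> (\<exists>k. A = {k}) \<or> p \<and> A = down b"
  proof (cases "\<exists>i\<in>A. \<exists>j\<in>A. i \<noteq> j")
    case True
    then obtain i j where ij: "i \<in> A" "j \<in> A" "i \<noteq> j" by blast
    have "A = {i, j}"
    proof (rule ccontr)
      assume "A \<noteq> {i, j}"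
      then obtain l where "l \<in> A" "l \<noteq> i" "l \<noteq> j" using ij by blast
      then show False using ab[of i j] ab[of i l] ij by (metis doubleton_eq_iff)
    qed
    then show ?thesis using ab[OF ij] down_b by simp
  next
    case False then show ?thesis by blast
  qed
next
  have "(b, a) \<notin> L" using rank_a_less[of b] a_neq_b by (simp add: L_iff_rank)
  then show "A = {} \<or> (\<exists>k. A = {k}) \<or> p \<and> A = down b \<Longrightarrow> poset_antichain (fork L a b p) A"
    unfolding down_b by (auto simp: poset_antichain_def fork_def)
qed

end

section \<open>Smoothness and unimodular equivalence\<close>

lemma int_latticeD: "x \<in> int_lattice \<Longrightarrow> x $ i \<in> \<int>"
  by (simp add: int_lattice_def)

text \<open>Generating the unit vectors over the integers gives a real spanning set; having d
  elements it is linearly independent over the reals, hence over the integers.\<close>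

lemma lattice_basisI:
  fixes B :: "(real ^ 'd::finite) set"
  assumes sub: "B \<subseteq> int_lattice" and card: "card B = CARD('d)"
    and span: "\<And>i. axis i 1 \<in> int_mod.span B"
  shows "lattice_basis B"
proof -
  have fin: "finite B" using card by (metis card.infinite zero_less_card_finite less_irrefl)
  have sub_span: "int_mod.span B \<subseteq> Real_Vector_Spaces.span B"
  proof
    fix x assume "x \<in> int_mod.span B"
    then show "x \<in> Real_Vector_Spaces.span B"
      by (induction rule: int_mod.span_induct_alt)
        (auto intro: span_zero span_add span_scale span_base)
  qed
  have "Basis \<subseteq> Real_Vector_Spaces.span B" using span sub_span by (auto simp: Basis_vec_def)
  then have "Real_Vector_Spaces.span Basis \<subseteq> Real_Vector_Spaces.span B" by (rule span_minimal) auto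
  then have "UNIV \<subseteq> Real_Vector_Spaces.span B" by simp
  then have indep: "Real_Vector_Spaces.independent B"
    by (rule card_le_dim_spanning[OF subset_UNIV _ fin]) (simp add: card dim_UNIV)
  have "\<not> int_mod.dependent B"
  proof
    assume "int_mod.dependent B"
    then obtain u v where u: "(\<Sum>v\<in>B. int_scale (u v) v) = 0" "v \<in> B" "u v \<noteq> 0"
      using int_mod.dependent_finite[OF fin] by blast
    then have "of_int (u v) = (0 :: real)" using indep fin by (intro independentD[of B B "\<lambda>v. of_int (u v)"]) auto
    then show False using u(3) by simp
  qed
  moreover have "int_mod.span B = int_lattice"
  proof
    show "int_mod.span B \<subseteq> int_lattice"
    proof
      fix x assume "x \<in> int_mod.span B"
      then show "x \<in> int_lattice"
        by (induction rule: int_mod.span_induct_alt) (use sub in \<open>auto simp: int_lattice_def\<close>)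
    qed
    show "int_lattice \<subseteq> int_mod.span B"
    proof
      fix x :: "real ^ 'd" assume x: "x \<in> int_lattice"
      have "x = (\<Sum>i\<in>UNIV. int_scale \<lfloor>x $ i\<rfloor> (axis i 1))"
        using int_latticeD[OF x] by (simp add: vec_eq_iff sum_component axis_def if_distrib cong: if_cong)
      also have "\<dots> \<in> int_mod.span B"
        by (intro int_mod.span_sum int_mod.span_scale span)
      finally show "x \<in> int_mod.span B" .
    qed
  qed
  ultimately show ?thesis by (simp add: lattice_basis_def)
qed

text \<open>An interior origin allows the facet hyperplane to be normalised to value 1. The origin
  is then outside the affine hull of the facet, and adjoining it yields full dimension, so the
  vertices of the facet span the space.\<close>

lemma facet_spanning:
  fixes V :: "(real ^ 'd::finite) set"
  assumes fin: "finite V" and zero: "0 \<in> interior (convex hull V)" and facet: "F facet_of convex hull V"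
  obtains c where "\<And>v. v \<in> V \<Longrightarrow> c \<bullet> v \<le> 1"
    "vertices F = {v \<in> vertices (convex hull V). c \<bullet> v = 1}" "span (vertices F) = UNIV"
proof -
  let ?S = "convex hull V"
  have face: "F face_of ?S" using facet by (rule facet_of_imp_face_of)
  have "polyhedron ?S" using fin by (intro polytope_imp_polyhedron polytope_convex_hull)
  then have "F exposed_face_of ?S" using face by (simp add: exposed_face_of_polyhedron)
  then obtain a b where ab: "?S \<subseteq> {x. a \<bullet> x \<le> b}" "F = ?S \<inter> {x. a \<bullet> x = b}"
    by (auto simp: exposed_face_of_def)
  have "a \<noteq> 0"
  proof
    assume "a = 0"
    then have "F = {} \<or> F = ?S" using ab(2) by auto
    then show False using facet by (auto simp: facet_of_def)
  qed
  then have "interior ?S \<subseteq> {x. a \<bullet> x < b}" using interior_mono[OF ab(1)] by simp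
  then have b: "b > 0" using zero by auto
  define c where "c = (1 / b) *\<^sub>R a"
  have cF: "F = ?S \<inter> {x. c \<bullet> x = 1}" using ab(2) b by (auto simp: c_def field_simps)
  have le: "c \<bullet> v \<le> 1" if "v \<in> V" for v
    using ab(1) hull_inc[OF that, of convex] b by (auto simp: c_def field_simps)
  have vert: "vertices F = {v \<in> vertices ?S. c \<bullet> v = 1}"
    using extreme_point_of_face[OF face] cF by (auto simp: vertices_def extreme_point_of_def)
  have hull: "F = convex hull (vertices F)"
    unfolding vertices_def
    by (intro Krein_Milman_Minkowski face_of_imp_compact[OF _ _ face] face_of_imp_convex[OF face])
      (auto simp: fin finite_imp_compact_convex_hull)
  have "affine hull F \<subseteq> {x. c \<bullet> x = 1}"
    by (rule hull_minimal) (auto simp: cF affine_hyperplane)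
  then have "0 \<notin> affine hull F" by auto
  moreover have "aff_dim ?S = DIM(real ^ 'd)" using zero by (intro aff_dim_nonempty_interior) auto
  ultimately have "aff_dim (insert 0 F) = DIM(real ^ 'd)"
    using facet by (simp add: aff_dim_insert facet_of_def)
  then have "dim (insert 0 F) = DIM(real ^ 'd)" using aff_dim_zero[of "insert 0 F"] by (simp add: hull_inc)
  then have "span F = UNIV" by (metis dim_eq_full span_insert_0)
  moreover have "span F \<subseteq> span (vertices F)"
    using hull convex_hull_subset_span[of "vertices F"] by (intro span_minimal) auto
  ultimately show thesis using that[OF le vert] by auto
qed

lemma det_int: "(\<And>i j. (U :: real ^ 'd ^ 'd::finite) $ i $ j \<in> \<int>) \<Longrightarrow> det U \<in> \<int>"
  unfolding det_def by (intro Ints_sum Ints_mult Ints_prod) auto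

text \<open>The determinants of \<open>U\<close> and \<open>V\<close> are integers with product 1,
  hence units. The matrix witnessing the equivalence from \<open>S\<close> to \<open>T\<close> is
  the inverse \<open>V\<close>.\<close>

lemma unimodularly_equivalentI:
  fixes U V :: "real ^ 'd ^ 'd::finite"
  assumes U: "\<And>i j. U $ i $ j \<in> \<int>" and V: "\<And>i j. V $ i $ j \<in> \<int>"
    and VU: "V ** U = mat 1" and img: "S = (\<lambda>v. v v* U) ` T"
  shows "unimodularly_equivalent S T"
proof -
  obtain m n where m: "det V = of_int m" and n: "det U = of_int n"
    using det_int[OF U] det_int[OF V] by (metis Ints_cases)
  have "det V * det U = 1" using VU by (metis det_mul det_I)
  then have "m * n = 1" unfolding m n by (metis of_int_mult of_int_eq_1_iff)
  then have "m = 1 \<or> m = - 1" using zmult_eq_1_iff by auto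
  then have "det V = 1 \<or> det V = - 1" using m by auto
  moreover have "T = (\<lambda>v. v v* V + 0) ` S"
    using VU matrix_left_right_inverse[of V U]
    unfolding img by (simp add: image_image vector_matrix_mul_assoc)
  moreover have "0 \<in> int_lattice" by (simp add: int_lattice_def)
  ultimately show ?thesis unfolding unimodularly_equivalent_def using V by blast
qed

text \<open>The translation vector \<open>w\<close> is the image of the interior point 0, hence an
  interior lattice point of \<open>T\<close>, hence 0.\<close>

lemma unimodular_linear:
  fixes S T :: "(real ^ 'd::finite) set"
  assumes "unimodularly_equivalent S T" and S: "Fano_polytope S" and T: "Fano_polytope T"
  obtains g :: "real ^ 'd \<Rightarrow> real ^ 'd" where "linear g" "inj g" "T = g ` S"
proof -
  obtain U w where U: "det U = 1 \<or> det U = - 1" "w \<in> int_lattice" "T = (\<lambda>v. v v* U + w) ` S"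
    using assms(1) unfolding unimodularly_equivalent_def by blast
  let ?g = "\<lambda>v. v v* U"
  have lin: "linear ?g"
    by (intro linearI) (simp_all add: vector_matrix_left_distrib scaleR_vector_matrix_assoc)
  have "invertible U" using U(1) by (auto simp: invertible_det_nz)
  then obtain V where "U ** V = mat 1" by (auto simp: invertible_def)
  then have "(v v* U) v* V = v" for v by (simp add: vector_matrix_mul_assoc)
  then have inj: "inj ?g" by (metis injI)
  have T_eq: "T = (+) w ` ?g ` S" using U(3) by (auto simp: image_image add.commute)
  have "interior T = (+) w ` ?g ` interior S"
    unfolding T_eq interior_translation interior_injective_linear_image[OF lin inj] ..
  moreover have "0 \<in> interior S" "interior T \<inter> int_lattice = {0}"
    using S T by (auto simp: Fano_polytope_def)
  ultimately have "w \<in> interior T" by force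
  then have "w = 0" using U(2) \<open>interior T \<inter> int_lattice = {0}\<close> by blast
  then show thesis using that[OF lin inj] T_eq by simp
qed

lemma vertices_linear_image:
  assumes "linear g" "inj g"
  shows "vertices (g ` S) = g ` vertices S"
proof -
  have "v extreme_point_of S \<longleftrightarrow> g v extreme_point_of g ` S" for v
    using face_of_linear_image[OF assms, of "{v}" S] by (simp add: face_of_singleton)
  then show ?thesis by (auto simp: vertices_def extreme_point_of_def)
qed

lemma rho_eq_sum: "rho T = (\<Sum>i\<in>T. rho {i})"
  by (simp add: rho_def)

text \<open>All generators have coordinates between -1 and 1, so interior points have coordinates
  strictly between, and an interior lattice point is 0.\<close>

lemma Fano_gens:
  fixes A B :: "'d::finite set \<Rightarrow> bool"
  assumes zero: "0 \<in> interior (convex hull (gens A B))"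
  shows "Fano_polytope (convex hull (gens A B))"
proof -
  let ?S = "convex hull (gens A B)"
  have "aff_dim ?S = int CARD('d)"
    using zero aff_dim_nonempty_interior[of ?S] by force
  moreover have "vertices ?S \<subseteq> int_lattice"
    unfolding vertices_gens[OF zero] using gens_subset rho_in_int_lattice by blast
  moreover have "x = 0" if x: "x \<in> interior ?S" "x \<in> int_lattice" for x
  proof -
    have "x $ i = 0" for i
    proof (rule Ints_nonzero_abs_less1)
      show "x $ i \<in> \<int>" using int_latticeD x(2) .
      have le: "rho {i} \<bullet> v \<le> 1" "rho {i} \<bullet> v \<ge> - 1" if "v \<in> gens A B" for v
        using that by (auto simp: gens_def inner_rho_singleton)
      have "?S \<subseteq> {x. rho {i} \<bullet> x \<le> 1}"
        by (rule hull_minimal) (use le in \<open>auto simp: convex_halfspace_le\<close>)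
      from interior_mono[OF this] have "rho {i} \<bullet> x < 1" using x(1) by auto
      moreover have "?S \<subseteq> {x. rho {i} \<bullet> x \<ge> - 1}"
        by (rule hull_minimal) (use le in \<open>auto simp: convex_halfspace_ge\<close>)
      from interior_mono[OF this] have "rho {i} \<bullet> x > - 1" using x(1) by auto
      ultimately show "\<bar>x $ i\<bar> < 1" by (simp add: rho_singleton inner_axis' abs_less_iff)
    qed
    then show "x = 0" by (simp add: vec_eq_iff)
  qed
  moreover have "0 \<in> int_lattice" by (simp add: int_lattice_def)
  ultimately show ?thesis
    using zero by (auto simp: Fano_polytope_def integral_full_polytope_def polytope_convex_hull)
qed

section \<open>Linear invariants of the vertex set\<close>

definition at_most_one_non_antipodal :: "(real ^ 'd::finite) set \<Rightarrow> bool" where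
  "at_most_one_non_antipodal V \<longleftrightarrow> (\<forall>u\<in>V. \<forall>v\<in>V. - u \<notin> V \<longrightarrow> - v \<notin> V \<longrightarrow> u = v)"

lemma at_most_one_non_antipodal_linear_image:
  assumes "linear g" "inj g"
  shows "at_most_one_non_antipodal (g ` V) \<longleftrightarrow> at_most_one_non_antipodal V"
  unfolding at_most_one_non_antipodal_def
  by (simp add: linear_neg[OF assms(1), symmetric] inj_image_mem_iff[OF assms(2)] inj_eq[OF assms(2)])

text \<open>A vertex from \<open>I\<close> lacks its antipode only if exactly one of
  \<open>A I\<close> and \<open>B I\<close> holds. This leaves \<open>D\<close>, and which of the
  two holds fixes the sign.\<close>

lemma at_most_one_non_antipodal_gens:
  assumes zero: "0 \<in> interior (convex hull (gens A B))"
    and D: "\<And>I. A I \<noteq> B I \<Longrightarrow> I = D"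
  shows "at_most_one_non_antipodal (vertices (convex hull (gens A B)))"
proof -
  have "u = rho D \<and> A D \<and> \<not> B D \<or> u = - rho D \<and> B D \<and> \<not> A D"
    if u: "u \<in> gens A B" "- u \<notin> gens A B" for u
  proof -
    from u(1) consider I where "u = rho I" "A I" | I where "u = - rho I" "B I"
      by (auto simp: gens_def)
    then show ?thesis
      by cases (use u(2) D in \<open>auto simp: gens_def\<close>)
  qed
  then show ?thesis
    unfolding at_most_one_non_antipodal_def vertices_gens[OF zero]
    by (metis DiffD1 DiffI empty_iff insert_iff neg_equal_0_iff_equal)
qed

text \<open>In \<open>\<Gamma>(\<O>(P), -\<C>(Q))\<close> with \<open>P \<noteq> Q\<close> the vertices \<open>\<plusminus>x, \<plusminus>y, u\<close> form a pentagon;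
  the two orders of \<open>P\<close> and \<open>Q\<close> are told apart by whether its odd vertex \<open>u\<close> is
  also a sum of two vertices outside the pentagon.\<close>

definition odd_vertex_decomposes :: "(real ^ 'd::finite) set \<Rightarrow> bool" where
  "odd_vertex_decomposes V \<longleftrightarrow>
    (\<exists>u\<in>V. \<exists>x\<in>V. \<exists>y\<in>V. \<exists>v\<in>V. \<exists>w\<in>V. - x \<in> V \<and> - y \<in> V \<and> - v \<notin> V \<and> u = x + y \<and> u = v + w)"

lemma odd_vertex_decomposes_linear_image:
  assumes "linear g" "inj g"
  shows "odd_vertex_decomposes (g ` V) \<longleftrightarrow> odd_vertex_decomposes V"
  unfolding odd_vertex_decomposes_def
  by (simp add: linear_neg[OF assms(1), symmetric] linear_add[OF assms(1), symmetric]
      inj_image_mem_iff[OF assms(2)] inj_eq[OF assms(2)])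

lemma vector_matrix_rho_singleton: "rho {i} v* (U :: real ^ 'd ^ 'd::finite) = U $ i"
proof -
  have "(\<Sum>k\<in>UNIV. rho {i} $ k * U $ k $ j) = (\<Sum>k\<in>UNIV. if k = i then U $ k $ j else 0)" for j
    by (rule sum.cong) (auto simp: rho_nth)
  then show ?thesis by (simp add: vector_matrix_mult_def vec_eq_iff)
qed

context forked_chain
begin

lemma rho_down_b: "rho (down b) = rho {a} + rho {b}"
  using a_neq_b by (simp add: down_b rho_insert rho_singleton)

lemma not_down_singleton: "{b} \<noteq> down k"
  using least a_neq_b by (auto simp: down_def)

lemma down_singletonD: "down k = {i} \<Longrightarrow> k = a \<and> i = a"
  using least[of k] self_in_down[of k] by (auto simp: down_def)

lemma OC_vertex_iff:
  assumes "I \<noteq> {}"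
  shows "rho I \<in> gens (poset_ideal (fork L a b p)) (poset_antichain (fork L a b q))
      \<longleftrightarrow> (\<exists>k. I = down k) \<or> p \<and> I = {b}"
    and "- rho I \<in> gens (poset_ideal (fork L a b p)) (poset_antichain (fork L a b q))
      \<longleftrightarrow> (\<exists>k. I = {k}) \<or> q \<and> I = down b"
  using assms by (simp_all add: rho_mem_gens uminus_rho_mem_gens ideal_fork_iff antichain_fork_iff)

lemma OC_cases:
  assumes "v \<in> gens (poset_ideal (fork L a b p)) (poset_antichain (fork L a b q))" "v \<noteq> 0"
  obtains k where "v = rho (down k)" | "p" "v = rho {b}" | k where "v = - rho {k}" | "q" "v = - rho (down b)"
  using assms by (auto simp: gens_def ideal_fork_iff antichain_fork_iff)

text \<open>The third smallest element of the chain, whose existence needs dimension at least three;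
  it supplies the vertices that distinguish the mixed polytope.\<close>

lemma third_element:
  assumes "CARD('d) \<ge> 3"
  obtains i where "i \<noteq> a" "i \<noteq> b" "down i = insert i (down b)"
proof -
  have "\<not> UNIV \<subseteq> {a, b}"
  proof
    assume "UNIV \<subseteq> {a, b}"
    then have "CARD('d) \<le> card {a, b}" by (intro card_mono) auto
    then show False using assms a_neq_b by simp
  qed
  then obtain i where i: "i \<in> - {a, b}" "\<forall>x\<in>- {a, b}. (i, x) \<in> L"
    using finite_total_least[OF poset total, of "- {a, b}"] by auto
  have "down i = insert i (down b)"
  proof
    show "down i \<subseteq> insert i (down b)"
      unfolding down_b using i is_posetD(2)[OF poset] by (auto simp: down_def)
    show "insert i (down b) \<subseteq> down i"
      unfolding down_b using i least second is_posetD(1)[OF poset] by (auto simp: down_def)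
  qed
  then show thesis using that i by auto
qed

lemma OC_two_non_antipodal:
  assumes card: "CARD('d) \<ge> 3"
    and zero: "0 \<in> interior (Gamma_OC (fork L a b p) (fork L a b q))"
  shows "\<not> at_most_one_non_antipodal (vertices (Gamma_OC (fork L a b p) (fork L a b q)))"
proof
  assume one: "at_most_one_non_antipodal (vertices (Gamma_OC (fork L a b p) (fork L a b q)))"
  obtain i where i: "i \<noteq> a" "i \<noteq> b" "down i = insert i (down b)"
    using third_element[OF card] .
  let ?G = "gens (poset_ideal (fork L a b p)) (poset_antichain (fork L a b q))"
  have "\<nexists>k. down i = {k}" using down_singletonD i(1) by blast
  moreover have "\<nexists>k. {i} = down k" using down_singletonD i(1) by metis
  \<comment> \<open>The three-element set \<open>down i\<close> is an ideal but not an antichain of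
    either fork, while {i} is an antichain but not an ideal.\<close>
  ultimately have "rho (down i) \<in> ?G - {0}" "- rho (down i) \<notin> ?G - {0}"
    "- rho {i} \<in> ?G - {0}" "- (- rho {i}) \<notin> ?G - {0}"
    using i(1,2) OC_vertex_iff[of "down i" p q] OC_vertex_iff[of "{i}" p q] by auto
  then have "rho (down i) = - rho {i}"
    using one unfolding at_most_one_non_antipodal_def Gamma_gens vertices_gens[OF zero[unfolded Gamma_gens]]
    by blast
  then show False by simp
qed

lemma OO_at_most_one_non_antipodal:
  "0 \<in> interior (Gamma_OO (fork L a b p) (fork L a b q)) \<Longrightarrow>
    at_most_one_non_antipodal (vertices (Gamma_OO (fork L a b p) (fork L a b q)))"
  unfolding Gamma_gens
  by (rule at_most_one_non_antipodal_gens[where D = "{b}"]) (auto simp: ideal_fork_iff)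

lemma CC_at_most_one_non_antipodal:
  "0 \<in> interior (Gamma_CC (fork L a b p) (fork L a b q)) \<Longrightarrow>
    at_most_one_non_antipodal (vertices (Gamma_CC (fork L a b p) (fork L a b q)))"
  unfolding Gamma_gens
  by (rule at_most_one_non_antipodal_gens[where D = "down b"]) (auto simp: antichain_fork_iff)

text \<open>The odd vertex is e_a + e_b, and it also equals \<open>rho (down i) - rho {i}\<close>
  for the third element \<open>i\<close>; \<open>rho (down i)\<close> has no antipode.\<close>

lemma OC_odd_vertex_decomposes:
  assumes card: "CARD('d) \<ge> 3"
    and zero: "0 \<in> interior (Gamma_OC (fork L a b True) (fork L a b False))"
  shows "odd_vertex_decomposes (vertices (Gamma_OC (fork L a b True) (fork L a b False)))"
proof -
  obtain i where i: "i \<noteq> a" "i \<noteq> b" "down i = insert i (down b)"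
    using third_element[OF card] .
  let ?V = "gens (poset_ideal (fork L a b True)) (poset_antichain (fork L a b False)) - {0}"
  note mem = OC_vertex_iff[where p = True and q = False]
  have "\<nexists>k. down i = {k}" using down_singletonD i(1) by blast
  then have "rho (down b) \<in> ?V" "rho {a} \<in> ?V" "rho {b} \<in> ?V" "rho (down i) \<in> ?V" "- rho {i} \<in> ?V"
    "- rho {a} \<in> ?V" "- rho {b} \<in> ?V" "- rho (down i) \<notin> ?V"
    using mem[of "down b"] mem[of "{a}"] mem[of "{b}"] mem[of "down i"] mem[of "{i}"] down_a by auto
  moreover have "i \<notin> down b" using i(1,2) down_b by simp
  then have "rho (down b) = rho (down i) + - rho {i}"
    unfolding i(3) by (simp add: rho_insert rho_singleton)
  ultimately show ?thesis
    unfolding odd_vertex_decomposes_def Gamma_gens vertices_gens[OF zero[unfolded Gamma_gens]]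
    using rho_down_b by blast
qed

text \<open>Here the antipodal vertices are e_a, e_a + e_b and their negatives, so the odd vertex is
  -e_b. Its only decomposition into two vertices is e_a - (e_a + e_b), and both summands have
  antipodes.\<close>

lemma OC_not_odd_vertex_decomposes:
  assumes zero: "0 \<in> interior (Gamma_OC (fork L a b False) (fork L a b True))"
  shows "\<not> odd_vertex_decomposes (vertices (Gamma_OC (fork L a b False) (fork L a b True)))"
proof
  let ?V = "gens (poset_ideal (fork L a b False)) (poset_antichain (fork L a b True)) - {0}"
  note mem = OC_vertex_iff[where p = False and q = True]
  assume "odd_vertex_decomposes (vertices (Gamma_OC (fork L a b False) (fork L a b True)))"
  then obtain u x y v w where V: "u \<in> ?V" "x \<in> ?V" "y \<in> ?V" "v \<in> ?V" "w \<in> ?V"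
    "- x \<in> ?V" "- y \<in> ?V" "- v \<notin> ?V" and u: "u = x + y" "u = v + w"
    unfolding odd_vertex_decomposes_def Gamma_gens vertices_gens[OF zero[unfolded Gamma_gens]]
    by blast
  have antipodal: "z \<in> {rho {a}, - rho {a}, rho {a} + rho {b}, - (rho {a} + rho {b})}"
    if "z \<in> ?V" "- z \<in> ?V" for z
  proof -
    have "z \<in> gens (poset_ideal (fork L a b False)) (poset_antichain (fork L a b True))" "z \<noteq> 0"
      using that by auto
    then show ?thesis
    proof (cases rule: OC_cases)
      case (1 k)
      then have "(\<exists>j. down k = {j}) \<or> down k = down b" using that(2) mem[of "down k"] by auto
      then have "k = a \<or> k = b" using down_singletonD down_inject by blast
      then show ?thesis using 1 rho_down_b down_a by (elim disjE) simp_all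
    next
      case (3 k)
      then have "\<exists>j. {k} = down j" using that(2) mem[of "{k}"] by auto
      then have "k = a" using down_singletonD by metis
      then show ?thesis using 3 by simp
    next
      case 4
      then show ?thesis by (simp add: rho_down_b)
    qed simp
  qed
  obtain T where T: "u = rho T \<or> u = - rho T" using V(1) gens_subset by blast
  then have "\<bar>u $ a\<bar> \<le> 1" by (auto simp: rho_nth)
  \<comment> \<open>The other sums of two antipodal vertices have \<open>a\<close>-coordinate 2 or
    -2.\<close>
  then have "u = 0 \<or> u = rho {b} \<or> u = - rho {b}"
    using antipodal[OF V(2,6)] antipodal[OF V(3,7)] a_neq_b unfolding u(1)
    by (elim insertE emptyE) (auto simp: rho_nth)
  moreover have "rho {b} \<notin> ?V"
    using mem[of "{b}"] not_down_singleton by auto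
  ultimately have ub: "u = - rho {b}" using V(1) by auto
  have b_eq: "v + w = - rho {b}" using u(2) ub by simp
  have mixed: "J = insert b I \<and> b \<notin> I" if "rho I - rho J = - rho {b}" for I J
  proof -
    have "(i \<in> J \<longleftrightarrow> i = b \<or> i \<in> I) \<and> (i = b \<longrightarrow> i \<notin> I)" for i
      using arg_cong[OF that, of "\<lambda>z. z $ i"] by (auto simp: rho_nth split: if_splits)
    then show ?thesis by blast
  qed
  have small: False if "rho I + rho J = rho {b}" "I \<noteq> {}" "J \<noteq> {}" for I J
  proof -
    have "(i \<in> I \<longrightarrow> i = b) \<and> (i \<in> J \<longrightarrow> i = b) \<and> \<not> (i \<in> I \<and> i \<in> J)" for i
      using arg_cong[OF that(1), of "\<lambda>z. z $ i"] by (auto simp: rho_nth split: if_splits)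
    then show False using that(2,3) by blast
  qed
  have pos: False if "rho I + rho J = - rho {b}" for I J
    using arg_cong[OF that, of "\<lambda>z. z $ b"] by (auto simp: rho_nth split: if_splits)
  \<comment> \<open>The set \<open>J\<close> arises from the nonempty \<open>I\<close> by adding
    \<open>b\<close>, so it is not a singleton.\<close>
  have key: "I = {a}" "J = down b"
    if "rho I - rho J = - rho {b}" "\<exists>k. I = down k" "(\<exists>k. J = {k}) \<or> J = down b" for I J
  proof -
    have J: "J = insert b I" "b \<notin> I" using mixed[OF that(1)] by auto
    show "J = down b" using J that(2,3) down_nonempty by (metis insert_not_empty insertI1 singleton_insert_inj_eq subset_empty subset_singletonD)
    then show "I = {a}" using J a_neq_b unfolding down_b by blast
  qed
  have Vcases: "(\<exists>I. z = rho I \<and> I \<noteq> {} \<and> (\<exists>k. I = down k)) \<or> (\<exists>J. z = - rho J \<and> J \<noteq> {} \<and> ((\<exists>k. J = {k}) \<or> J = down b))"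
    if "z \<in> ?V" for z
    using that by (auto simp: gens_def ideal_fork_iff antichain_fork_iff)
  have "v = rho {a} \<or> v = - rho (down b)"
    using Vcases[OF V(4)]
  proof
    assume "\<exists>I. v = rho I \<and> I \<noteq> {} \<and> (\<exists>k. I = down k)"
    then obtain I where I: "v = rho I" "\<exists>k. I = down k" by blast
    then obtain J where J: "w = - rho J" "(\<exists>k. J = {k}) \<or> J = down b"
      using Vcases[OF V(5)] pos b_eq by blast
    then have "I = {a}" using key(1)[of I J] I b_eq by simp
    then show ?thesis using I(1) by simp
  next
    assume "\<exists>J. v = - rho J \<and> J \<noteq> {} \<and> ((\<exists>k. J = {k}) \<or> J = down b)"
    then obtain J where J: "v = - rho J" "J \<noteq> {}" "(\<exists>k. J = {k}) \<or> J = down b" by blast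
    have "\<exists>I. w = rho I \<and> (\<exists>k. I = down k)"
      using Vcases[OF V(5)]
    proof
      assume "\<exists>J. w = - rho J \<and> J \<noteq> {} \<and> ((\<exists>k. J = {k}) \<or> J = down b)"
      then obtain K where K: "w = - rho K" "K \<noteq> {}" by blast
      have "rho J + rho K = - (v + w)" using J(1) K(1) by simp
      then have "rho J + rho K = rho {b}" using b_eq by simp
      then show ?thesis using small J(2) K(2) by blast
    qed blast
    then obtain I where I: "w = rho I" "\<exists>k. I = down k" by blast
    then have "J = down b" using key(2)[of I J] J b_eq by simp
    then show ?thesis using J(1) by simp
  qed
  then show False
    using V(8) mem[of "{a}"] mem[of "down b"] down_a by auto
qed

section \<open>The unimodular map from the chain to the order version\<close>

text \<open>The map \<open>g\<close> exchanges singletons for principal ideals. The sign at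
  \<open>a\<close> makes it send e_a + e_b to e_b, so the extra antichain goes to the extra ideal;
  at \<open>a\<close> itself the sign is harmless, since e_a and -e_a both occur.\<close>

lemma OO_CC_unimodularly_equivalent:
  "unimodularly_equivalent (Gamma_OO (fork L a b p) (fork L a b q)) (Gamma_CC (fork L a b p) (fork L a b q))"
proof -
  define U :: "real ^ 'd ^ 'd" where "U = (\<chi> i. if i = a then - rho {a} else rho (down i))"
  define g where "g v = v v* U" for v
  have lin: "linear g"
    unfolding g_def by (intro linearI) (simp_all add: vector_matrix_left_distrib scaleR_vector_matrix_assoc)
  note [simp] = linear_neg[OF lin] linear_0[OF lin]
  have g_single: "g (rho {i}) = (if i = a then - rho (down a) else rho (down i))" for i
    unfolding g_def vector_matrix_rho_singleton by (simp add: U_def down_a)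
  have g_b: "g (rho (down b)) = rho {b}"
    unfolding rho_down_b linear_add[OF lin] g_single using a_neq_b rho_down_b by (simp add: down_a)
  \<comment> \<open>The image of the lattice under \<open>g\<close>. It contains every
    \<open>rho (down k)\<close>, hence by differences every unit vector; integral preimages of the
    unit vectors are the rows of the inverse matrix.\<close>
  define H where "H = {x. \<exists>w\<in>int_lattice. g w = x}"
  have H_down: "rho (down k) \<in> H" for k
  proof (cases "k = a")
    case True
    then have "g (- rho {a}) = rho (down k)" by (simp add: g_single)
    then show ?thesis unfolding H_def using rho_in_int_lattice by blast
  next
    case False
    then have "g (rho {k}) = rho (down k)" by (simp add: g_single)
    then show ?thesis unfolding H_def using rho_in_int_lattice by blast
  qed
  have H_diff: "x - y \<in> H" if "x \<in> H" "y \<in> H" for x y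
  proof -
    from that obtain v w where "v \<in> int_lattice" "w \<in> int_lattice" "g v = x" "g w = y" by (auto simp: H_def)
    then have "v - w \<in> int_lattice" "g (v - w) = x - y"
      by (auto simp: int_lattice_def linear_diff[OF lin])
    then show ?thesis by (auto simp: H_def)
  qed
  have "rho {k} \<in> H" for k
  proof (cases "k = a")
    case True then show ?thesis using H_down[of a] by (simp add: down_a)
  next
    case False
    then obtain j where "down k = insert k (down j)" "k \<notin> down j" using down_pred by blast
    then have "rho {k} = rho (down k) - rho (down j)" by (simp add: rho_insert rho_singleton)
    then show ?thesis using H_diff H_down by simp
  qed
  then have "\<forall>k. \<exists>w. w \<in> int_lattice \<and> w v* U = rho {k}" unfolding H_def g_def by blast
  then obtain h where h: "\<And>k. h k \<in> int_lattice" "\<And>k. h k v* U = rho {k}" by metis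
  have "(\<chi> k. h k) ** U = mat 1"
  proof -
    have "((\<chi> k. h k) ** U) $ i = h i v* U" for i
      by (simp add: matrix_matrix_mult_def vector_matrix_mult_def vec_eq_iff)
    then show ?thesis using h(2) by (auto simp: vec_eq_iff mat_def rho_nth)
  qed
  moreover have "Gamma_OO (fork L a b p) (fork L a b q) = g ` Gamma_CC (fork L a b p) (fork L a b q)"
  proof -
    let ?O = "gens (poset_ideal (fork L a b p)) (poset_ideal (fork L a b q))"
    let ?C = "gens (poset_antichain (fork L a b p)) (poset_antichain (fork L a b q))"
    have "g ` ?C \<subseteq> ?O"
    proof (rule image_subsetI)
      fix v assume "v \<in> ?C"
      then consider "v = 0" | i where "v = rho {i}" | i where "v = - rho {i}"
        | "v = rho (down b)" p | "v = - rho (down b)" q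
        by (auto simp: gens_def antichain_fork_iff)
      then show "g v \<in> ?O"
        by cases (auto simp: g_single g_b gens_def ideal_fork_iff)
    qed
    moreover have "?O \<subseteq> g ` ?C"
    proof
      fix v assume "v \<in> ?O"
      then consider "v = 0" | k where "v = rho (down k)" | k where "v = - rho (down k)"
        | "v = rho {b}" p | "v = - rho {b}" q
        by (auto simp: gens_def ideal_fork_iff)
      then show "v \<in> g ` ?C"
      proof cases
        case (2 k)
        then have "v = g (if k = a then - rho {a} else rho {k})" by (simp add: g_single)
        then show ?thesis by (rule image_eqI) (auto simp: gens_def antichain_fork_iff)
      next
        case (3 k)
        then have "v = g (if k = a then rho {a} else - rho {k})" by (simp add: g_single)
        then show ?thesis by (rule image_eqI) (auto simp: gens_def antichain_fork_iff)
      next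
        case 1
        then have "v = g 0" by simp
        then show ?thesis by (rule image_eqI) (auto simp: gens_def antichain_fork_iff intro!: exI[of _ "{}"])
      next
        case 4
        then have "v = g (rho (down b))" by (simp add: g_b)
        then show ?thesis by (rule image_eqI) (use 4 in \<open>auto simp: gens_def antichain_fork_iff\<close>)
      next
        case 5
        then have "v = g (- rho (down b))" by (simp add: g_b)
        then show ?thesis by (rule image_eqI) (use 5 in \<open>auto simp: gens_def antichain_fork_iff\<close>)
      qed
    qed
    ultimately show ?thesis unfolding Gamma_gens convex_hull_linear_image[OF lin] by simp
  qed
  ultimately show ?thesis
    using h(1) unfolding g_def
    by (intro unimodularly_equivalentI[where V = "\<chi> k. h k" and U = U])
      (auto simp: U_def rho_nth int_lattice_def)
qed

section \<open>Smoothness of the mixed polytope\<close>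

text \<open>Otherwise some nonzero \<open>c\<close> is nonnegative on all generators. The generators
  -e_i make its coordinates nonpositive, and \<open>rho (down k)\<close> then forces the coordinate
  of \<open>k\<close> to be 0.\<close>

lemma OC_0_interior: "0 \<in> interior (Gamma_OC (fork L a b p) (fork L a b q))"
proof (rule ccontr)
  let ?V = "gens (poset_ideal (fork L a b p)) (poset_antichain (fork L a b q))"
  let ?S = "convex hull ?V"
  assume "0 \<notin> interior (Gamma_OC (fork L a b p) (fork L a b q))"
  then have notin: "0 \<notin> interior ?S" by (simp add: Gamma_gens)
  have V: "0 \<in> ?V" "- rho {i} \<in> ?V" "rho (down i) \<in> ?V" for i
    by (auto simp: gens_def ideal_fork_iff antichain_fork_iff intro: exI[of _ "{}"])
  have zero: "0 \<in> ?S" using V(1) by (rule hull_inc)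
  have "rho {i} \<in> span ?S" for i
    using span_neg[OF span_base[OF hull_inc[OF V(2)[of i], of convex]]] by simp
  then have "Basis \<subseteq> span ?S" by (auto simp: Basis_vec_def rho_singleton)
  then have "span Basis \<subseteq> span ?S" by (rule span_minimal) auto
  then have "span ?S = UNIV" by auto
  then have "affine hull ?S = UNIV" using affine_hull_span_0[OF hull_inc[OF zero]] by argo
  then have "0 \<notin> rel_interior ?S" using notin rel_interior_interior by metis
  then obtain c where c: "c \<noteq> 0" "\<And>y. y \<in> ?S \<Longrightarrow> c \<bullet> 0 \<le> c \<bullet> y"
    using supporting_hyperplane_rel_boundary[of ?S 0] zero by (metis convex_convex_hull)
  have ge: "c \<bullet> v \<ge> 0" if "v \<in> ?V" for v using c(2)[OF hull_inc[OF that]] by simp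
  have nonpos: "c $ i \<le> 0" for i using ge[OF V(2)[of i]] by (simp add: inner_rho_right)
  have "c $ k = 0" for k
  proof -
    have "0 \<le> (\<Sum>i\<in>down k. c $ i)" using ge[OF V(3)[of k]] by (simp add: inner_rho_right)
    also have "\<dots> = c $ k + (\<Sum>i\<in>down k - {k}. c $ i)" by (rule sum.remove) auto
    also have "\<dots> \<le> c $ k" using nonpos by (simp add: sum_nonpos)
    finally show ?thesis using nonpos[of k] by simp
  qed
  then show False using c(1) by (simp add: vec_eq_iff)
qed

text \<open>The vertices of a facet in the plane of e_a and e_b lie in a two-element integral basis
  of that plane. Only an inclusion is claimed; equality comes later from counting.\<close>

lemma OC_bottom_facet_part:
  fixes c :: "real ^ 'd"
  assumes le: "\<And>v. v \<in> gens (poset_ideal (fork L a b p)) (poset_antichain (fork L a b q)) \<Longrightarrow> c \<bullet> v \<le> 1"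
  defines "W \<equiv> {v \<in> gens (poset_ideal (fork L a b p)) (poset_antichain (fork L a b q)). c \<bullet> v = 1}
    \<inter> {rho {a}, - rho {a}, rho {b}, - rho {b}, rho (down b), - rho (down b)}"
  obtains u v where "W \<subseteq> {u, v}" "rho {a} \<in> int_mod.span {u, v}" "rho {b} \<in> int_mod.span {u, v}"
proof -
  define \<alpha> \<beta> where "\<alpha> = c $ a" and "\<beta> = c $ b"
  have c: "c \<bullet> rho {a} = \<alpha>" "c \<bullet> rho {b} = \<beta>" "c \<bullet> rho (down b) = \<alpha> + \<beta>"
    by (simp_all add: \<alpha>_def \<beta>_def rho_down_b inner_add_right inner_rho_right)
  let ?V = "gens (poset_ideal (fork L a b p)) (poset_antichain (fork L a b q))"
  have V: "rho {a} \<in> ?V" "- rho {a} \<in> ?V" "- rho {b} \<in> ?V" "rho (down b) \<in> ?V"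
    "rho {b} \<in> ?V \<longleftrightarrow> p" "- rho (down b) \<in> ?V \<longleftrightarrow> q"
    using OC_vertex_iff[of "{a}" p q] OC_vertex_iff[of "{b}" p q] OC_vertex_iff[of "down b" p q]
      down_a not_down_singleton down_singletonD[of b] a_neq_b by auto
  have bounds: "\<alpha> \<le> 1" "- 1 \<le> \<alpha>" "- 1 \<le> \<beta>" "\<alpha> + \<beta> \<le> 1" "p \<Longrightarrow> \<beta> \<le> 1" "q \<Longrightarrow> - 1 \<le> \<alpha> + \<beta>"
    using le[OF V(1)] le[OF V(2)] le[OF V(3)] le[OF V(4)] le[OF V(5)[THEN iffD2]] le[OF V(6)[THEN iffD2]]
    by (simp_all add: c)
  have W: "v = rho {a} \<and> \<alpha> = 1 \<or> v = - rho {a} \<and> \<alpha> = - 1 \<or> v = rho {b} \<and> \<beta> = 1 \<and> p \<or> v = - rho {b} \<and> \<beta> = - 1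
      \<or> v = rho (down b) \<and> \<alpha> + \<beta> = 1 \<or> v = - rho (down b) \<and> \<alpha> + \<beta> = - 1 \<and> q" if "v \<in> W" for v
  proof -
    have "v \<in> ?V" "c \<bullet> v = 1"
      "v \<in> {rho {a}, - rho {a}, rho {b}, - rho {b}, rho (down b), - rho (down b)}"
      using that by (simp_all add: W_def)
    then show ?thesis
      by (elim insertE emptyE) (auto simp: c V(5,6))
  qed
  have combination: "x \<in> int_mod.span {u, v}" if "x = int_scale m u + int_scale n v"
    for x u v :: "real ^ 'd" and m n
    unfolding that by (intro int_mod.span_add int_mod.span_scale int_mod.span_base) auto
  note spanning = that
  have thesisI: thesis
    if "W \<subseteq> {u, v}" "rho {a} = int_scale m u + int_scale n v" "rho {b} = int_scale k u + int_scale l v"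
    for u v k l m n
    by (rule spanning[OF that(1) combination[OF that(2)] combination[OF that(3)]])
  \<comment> \<open>The cases follow the possible edges of the polygon in this plane. The value 2
    for \<beta> is possible only if \<open>p\<close> is false, when {b} is not an ideal.\<close>
  consider "\<alpha> = 1" "\<beta> = - 1" | "\<alpha> = 1" "\<beta> \<noteq> - 1" | "\<alpha> = - 1" "\<beta> = 1" | "\<alpha> = - 1" "\<beta> = 2"
    | "\<alpha> = - 1" "\<beta> = 0" | "\<alpha> = - 1" "\<beta> \<noteq> 0" "\<beta> \<noteq> 1" "\<beta> \<noteq> 2"
    | "\<alpha> \<noteq> 1" "\<alpha> \<noteq> - 1" "\<beta> \<noteq> - 1" "\<alpha> + \<beta> \<noteq> - 1" | "\<alpha> \<noteq> 1" "\<alpha> \<noteq> - 1" "\<beta> = - 1 \<or> \<alpha> + \<beta> = - 1"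
    by blast
  then show thesis
  proof cases
    case 1
    then have "W \<subseteq> {rho {a}, - rho {b}}" using W by fastforce
    then show thesis by (rule thesisI[of _ _ 1 0 0 "- 1"]) auto
  next
    case 2
    then have "W \<subseteq> {rho {a}, rho (down b)}" using W bounds by fastforce
    then show thesis by (rule thesisI[of _ _ 1 0 "- 1" 1]) (auto simp: rho_down_b)
  next
    case 3
    then have "W \<subseteq> {- rho {a}, rho {b}}" using W by fastforce
    then show thesis by (rule thesisI[of _ _ "- 1" 0 0 1]) auto
  next
    case 4
    then have "W \<subseteq> {- rho {a}, rho (down b)}" using W by fastforce
    then show thesis by (rule thesisI[of _ _ "- 1" 0 1 1]) (auto simp: rho_down_b)
  next
    case 5
    then have "W \<subseteq> {- rho {a}, - rho (down b)}" using W by fastforce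
    then show thesis by (rule thesisI[of _ _ "- 1" 0 1 "- 1"]) (auto simp: rho_down_b)
  next
    case 6
    then have "W \<subseteq> {- rho {a}, - rho {b}}" using W by fastforce
    then show thesis by (rule thesisI[of _ _ "- 1" 0 0 "- 1"]) auto
  next
    case 7
    then have "W \<subseteq> {rho {b}, rho (down b)}" using W by fastforce
    then show thesis by (rule thesisI[of _ _ "- 1" 1 1 0]) (auto simp: rho_down_b)
  next
    case 8
    then have "W \<subseteq> {- rho {b}, - rho (down b)}" using W bounds by fastforce
    then show thesis by (rule thesisI[of _ _ 1 "- 1" "- 1" 0]) (auto simp: rho_down_b)
  qed
qed

text \<open>A facet must contain \<open>d\<close> vertices. It has at most one from each pair
  \<open>\<rho>(down i), -e_i\<close> with \<open>i \<notin> {a, b}\<close> and at most two from the plane of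
  \<open>e_a, e_b\<close>, so these bounds are attained and the unit vectors are recovered by going
  up \<open>L\<close>.\<close>

lemma OC_smooth: "smooth_Fano_polytope (Gamma_OC (fork L a b p) (fork L a b q))"
  unfolding smooth_Fano_polytope_def
proof (intro conjI allI impI)
  let ?V = "gens (poset_ideal (fork L a b p)) (poset_antichain (fork L a b q))"
  note zero = OC_0_interior[of p q, unfolded Gamma_gens]
  show "Fano_polytope (Gamma_OC (fork L a b p) (fork L a b q))"
    unfolding Gamma_gens using zero by (rule Fano_gens)
  fix F assume "F facet_of Gamma_OC (fork L a b p) (fork L a b q)"
  then have "F facet_of convex hull ?V" by (simp add: Gamma_gens)
  then obtain c where c: "\<And>v. v \<in> ?V \<Longrightarrow> c \<bullet> v \<le> 1"
    and vert: "vertices F = {v \<in> vertices (convex hull ?V). c \<bullet> v = 1}"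
    and span: "span (vertices F) = UNIV"
    by (rule facet_spanning[OF finite_gens zero]) (rule that)
  define T where "T = {v \<in> ?V. c \<bullet> v = 1}"
  have T: "vertices F = T" unfolding vert vertices_gens[OF zero] T_def by auto
  have finT: "finite T" unfolding T_def by simp
  \<comment> \<open>The blocks are indexed by the elements other than \<open>a\<close>; the block of
    \<open>b\<close> takes the whole plane of e_a and e_b.\<close>
  define B where "B i = (if i = b then {rho {a}, - rho {a}, rho {b}, - rho {b}, rho (down b), - rho (down b)}
    else {rho (down i), - rho {i}})" for i
  have Bb: "T \<inter> B b = {v \<in> ?V. c \<bullet> v = 1}
      \<inter> {rho {a}, - rho {a}, rho {b}, - rho {b}, rho (down b), - rho (down b)}"
    by (simp add: T_def B_def)
  obtain u v where uv: "T \<inter> B b \<subseteq> {u, v}" "rho {a} \<in> int_mod.span {u, v}" "rho {b} \<in> int_mod.span {u, v}"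
    by (rule OC_bottom_facet_part[of p q c, folded Bb], erule c, rule that)
  \<comment> \<open>With both vectors on the facet, the predecessor \<open>j\<close> of
    \<open>i\<close> would give \<open>c\<close> the value 2 on \<open>rho (down j)\<close>.\<close>
  have not_both: "\<not> (rho (down i) \<in> T \<and> - rho {i} \<in> T)" if "i \<noteq> a" for i
  proof
    assume "rho (down i) \<in> T \<and> - rho {i} \<in> T"
    then have 1: "c \<bullet> rho (down i) = 1" "c \<bullet> rho {i} = - 1" by (auto simp: T_def)
    obtain j where "down i = insert i (down j)" "i \<notin> down j" using down_pred[OF \<open>i \<noteq> a\<close>] by blast
    then have "c \<bullet> rho (down i) = c \<bullet> rho {i} + c \<bullet> rho (down j)"
      by (simp add: rho_insert rho_singleton inner_add_right)
    moreover have "c \<bullet> rho (down j) \<le> 1"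
      by (rule c) (auto simp: gens_def ideal_fork_iff)
    ultimately show False using 1 by simp
  qed
  have le: "card (T \<inter> B i) \<le> (if i = b then 2 else 1)" if "i \<in> - {a}" for i
  proof (cases "i = b")
    case True
    have "card (T \<inter> B b) \<le> card {u, v}" using uv(1) by (intro card_mono) auto
    also have "\<dots> \<le> 2" by (simp add: card_insert_if)
    finally show ?thesis using True by simp
  next
    case False
    have "T \<inter> B i \<subseteq> {if rho (down i) \<in> T then rho (down i) else - rho {i}}"
      using not_both[of i] that False by (auto simp: B_def)
    then have "card (T \<inter> B i) \<le> card {if rho (down i) \<in> T then rho (down i) else - rho {i}}"
      by (intro card_mono) auto
    then show ?thesis using False by simp
  qed
  have total: "(\<Sum>i\<in>- {a}. if i = b then 2 else 1) = CARD('d)"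
  proof -
    have "(\<Sum>i\<in>- {a}. if i = b then 2 else 1) = (\<Sum>i\<in>- {a}. 1 + (if i = b then 1 else 0 :: nat))"
      by (rule sum.cong) auto
    also have "\<dots> = card (- {a}) + 1" unfolding sum.distrib using a_neq_b by simp
    also have "\<dots> = CARD('d)" by (simp add: Compl_eq_Diff_UNIV card_Diff_singleton)
    finally show ?thesis .
  qed
  have "T \<subseteq> (\<Union>i\<in>- {a}. T \<inter> B i)"
  proof
    fix x assume x: "x \<in> T"
    then have "x \<in> ?V" "x \<noteq> 0" by (auto simp: T_def)
    then show "x \<in> (\<Union>i\<in>- {a}. T \<inter> B i)"
    proof (cases rule: OC_cases)
      case (1 k)
      then show ?thesis using x a_neq_b down_a by (cases "k = a") (auto simp: B_def)
    next
      case (3 k)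
      then show ?thesis using x a_neq_b by (cases "k = a") (auto simp: B_def)
    qed (use x a_neq_b in \<open>auto simp: B_def\<close>)
  qed
  then have "card T \<le> card (\<Union>i\<in>- {a}. T \<inter> B i)" using finT by (intro card_mono) auto
  also have "\<dots> \<le> (\<Sum>i\<in>- {a}. card (T \<inter> B i))" by (rule card_UN_le) simp
  finally have card_T: "card T \<le> (\<Sum>i\<in>- {a}. card (T \<inter> B i))" .
  have sum_le: "(\<Sum>i\<in>- {a}. card (T \<inter> B i)) \<le> CARD('d)"
    unfolding total[symmetric] by (rule sum_mono) (rule le)
  have "dim (UNIV :: (real ^ 'd) set) \<le> card T"
    using span finT unfolding T by (intro dim_le_card) auto
  then have ge: "CARD('d) \<le> card T" by (simp add: dim_UNIV)
  \<comment> \<open>The block bounds add up to d, and a spanning set has at least d elements, so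
    every block attains its bound.\<close>
  have sum_eq: "(\<Sum>i\<in>- {a}. card (T \<inter> B i)) = (\<Sum>i\<in>- {a}. if i = b then 2 else 1)"
    using card_T sum_le ge total by linarith
  have eq: "card (T \<inter> B i) = (if i = b then 2 else 1)" if "i \<noteq> a" for i
    using sum_mono_inv[OF sum_eq le, of i] that by simp
  have "T \<inter> B b = {u, v}"
  proof (rule card_subset_eq)
    have "card {u, v} \<le> 2" by (simp add: card_insert_if)
    moreover have "card (T \<inter> B b) \<le> card {u, v}" using uv(1) by (intro card_mono) auto
    ultimately show "card (T \<inter> B b) = card {u, v}" using eq[of b] a_neq_b by simp
  qed (use uv(1) in auto)
  then have "int_mod.span {u, v} \<subseteq> int_mod.span T" by (intro int_mod.span_mono) auto
  then have ab_span: "rho {a} \<in> int_mod.span T" "rho {b} \<in> int_mod.span T" using uv(2,3) by auto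
  \<comment> \<open>Each block above \<open>b\<close> contributes \<open>rho (down k)\<close> or
    \<open>- rho {k}\<close>; either yields \<open>rho {k}\<close> once the unit vectors of smaller
    rank are available.\<close>
  have "rho {k} \<in> int_mod.span T" for k
  proof (induction "rank k" arbitrary: k rule: less_induct)
    case less
    show ?case
    proof (cases "k = a \<or> k = b")
      case False
      obtain j where j: "rank j < rank k" "down k = insert k (down j)" "k \<notin> down j"
        using down_pred[of k] False by blast
      have "rho (down j) \<in> int_mod.span T"
        unfolding rho_eq_sum[of "down j"] using less j(1)
        by (intro int_mod.span_sum) (auto simp: in_down_iff)
      moreover have "T \<inter> B k \<noteq> {}" using eq[of k] False by auto
      then have "rho (down k) \<in> T \<or> - rho {k} \<in> T" using False by (auto simp: B_def)
      moreover have "rho {k} = rho (down k) - rho (down j)"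
        using j by (simp add: rho_insert rho_singleton)
      ultimately show ?thesis
        using int_mod.span_base[of "rho (down k)" T] int_mod.span_neg[OF int_mod.span_base[of "- rho {k}" T]]
        by (auto intro: int_mod.span_diff)
    qed (use ab_span in auto)
  qed
  moreover have "T \<subseteq> int_lattice" unfolding T_def using gens_subset rho_in_int_lattice by blast
  moreover have "card T = CARD('d)" using card_T sum_le ge by linarith
  ultimately show "lattice_basis (vertices F)"
    unfolding T by (intro lattice_basisI) (auto simp: rho_singleton[symmetric])
qed

lemma OC_OC_not_equivalent:
  assumes card: "CARD('d) \<ge> 3" and "p \<noteq> q"
  shows "\<not> unimodularly_equivalent (Gamma_OC (fork L a b q) (fork L a b p)) (Gamma_OC (fork L a b p) (fork L a b q))"
proof
  note zero = OC_0_interior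
  note Fano = OC_smooth[unfolded smooth_Fano_polytope_def, THEN conjunct1]
  assume "unimodularly_equivalent (Gamma_OC (fork L a b q) (fork L a b p)) (Gamma_OC (fork L a b p) (fork L a b q))"
  then obtain g where "linear g" "inj g"
    "Gamma_OC (fork L a b p) (fork L a b q) = g ` Gamma_OC (fork L a b q) (fork L a b p)"
    using unimodular_linear[OF _ Fano Fano] by metis
  then have "odd_vertex_decomposes (vertices (Gamma_OC (fork L a b p) (fork L a b q)))
      \<longleftrightarrow> odd_vertex_decomposes (vertices (Gamma_OC (fork L a b q) (fork L a b p)))"
    by (simp add: vertices_linear_image odd_vertex_decomposes_linear_image)
  then show False
    using OC_odd_vertex_decomposes[OF card zero] OC_not_odd_vertex_decomposes[OF zero] \<open>p \<noteq> q\<close>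
    by (cases p; cases q; simp)
qed

end

section \<open>Combining classification and invariants\<close>

lemma not_equivalent_if_at_most_one_non_antipodal:
  assumes "Fano_polytope S" "Fano_polytope T"
    and "\<not> at_most_one_non_antipodal (vertices S)" "at_most_one_non_antipodal (vertices T)"
  shows "\<not> unimodularly_equivalent S T"
  using assms unimodular_linear
  by (metis vertices_linear_image at_most_one_non_antipodal_linear_image)

theorem theorem3p1:
  fixes P Q :: "'d::finite rel"
  assumes "CARD('d) \<ge> 3"
    and "is_poset P" and "is_poset Q"
    and "smooth_Fano_polytope (Gamma_OO P Q)"
    and "smooth_Fano_polytope (Gamma_OC P Q)"
    and "smooth_Fano_polytope (Gamma_CC P Q)"
  shows "unimodularly_equivalent (Gamma_OO P Q) (Gamma_CC P Q)
    \<and> \<not> unimodularly_equivalent (Gamma_OC P Q) (Gamma_OO P Q)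
    \<and> \<not> unimodularly_equivalent (Gamma_OC P Q) (Gamma_CC P Q)
    \<and> (P \<noteq> Q \<longrightarrow>
          smooth_Fano_polytope (Gamma_OC Q P)
        \<and> \<not> unimodularly_equivalent (Gamma_OC Q P) (Gamma_OC P Q))"
proof -
  have "unique_minimal_pairs P"
    unfolding unique_minimal_pairs_def
    using CC_incomparable_unique[OF disjI1[OF assms(6)] assms(2)]
      OO_incomparable_minimal[OF disjI1[OF assms(4)] assms(2)] by blast
  moreover have "unique_minimal_pairs Q"
    unfolding unique_minimal_pairs_def
    using CC_incomparable_unique[OF disjI2[OF assms(6)] assms(3)]
      OO_incomparable_minimal[OF disjI2[OF assms(4)] assms(3)] by blast
  moreover have "CARD('d) \<ge> 2" using assms(1) by simp
  ultimately obtain L a b p q where "forked_chain L a b"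
    and P: "P = fork L a b p" and Q: "Q = fork L a b q"
    using fork_cases[of P Q] assms(2,3) OO_no_reversed_pair[OF assms(4)]
      CC_incomparable_agree[OF assms(6,2,3)] by metis
  then interpret forked_chain L a b by simp
  have Fano: "Fano_polytope (Gamma_OO P Q)" "Fano_polytope (Gamma_OC P Q)" "Fano_polytope (Gamma_CC P Q)"
    using assms(4-6) by (simp_all add: smooth_Fano_polytope_def)
  note zero = assms(4-6)[THEN smooth_imp_0_interior, unfolded P Q]
  note two = OC_two_non_antipodal[OF assms(1) zero(2), folded P Q]
  have "P \<noteq> Q \<Longrightarrow> p \<noteq> q" by (rule notI) (simp add: P Q)
  then show ?thesis
    using OO_CC_unimodularly_equivalent[of p q, folded P Q] OC_smooth[of q p, folded P Q]
      OC_OC_not_equivalent[OF assms(1), of p q, folded P Q]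
      not_equivalent_if_at_most_one_non_antipodal[OF Fano(2,1) two OO_at_most_one_non_antipodal[OF zero(1), folded P Q]]
      not_equivalent_if_at_most_one_non_antipodal[OF Fano(2,3) two CC_at_most_one_non_antipodal[OF zero(3), folded P Q]]
    by blast
qed

end
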